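(* Let $\zeta=\min\mathscr M_H$ be the least minimum point of the Hamiltonian $H$ (so $\zeta\ge 0$). The value function $v$ is bounded, satisfies $$ v(x)\le \frac{H(0)}{\beta}=\lim_{y\to\infty} v(y),\qquad x\ge 0,$$ and admits the following representation: (i) if $\zeta=0$, then $v(x)=H(0)/\beta$ for all $x\ge 0$; (ii) if $\zeta>0$, then for all $x\ge 0$ $$v(x)=\frac{H(\xi(x))}{\beta}=\frac{H(\zeta)}{\beta}+\int_0^x\xi(y)\,dy,$$ where $\xi(x)\in(0,\zeta]$ is defined by the equation $$x=\Psi(\xi):=-\int_\xi^{\zeta}\frac{H'(z)}{\beta z}\,dz,\quad \xi\in (0,\zeta],\quad x\ge 0.$$ In case (ii), $v$ is strictly increasing and strictly concave. Moreover, $v'$ is absolutely continuous on $[0,\infty)$ and satisfies $v'(0)=\zeta$ and $\lim_{x\to\infty} v'(x)=0$. Finally, $v''<0$ a.e. on $(0,\infty)$.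
   Context: Setting. $\mathbb R_+=[0,\infty)$. $A\subset\mathbb R_+$ is a closed set and $Q\subset\mathbb R_+$ is a compact set, with $0\in A\cap Q$, $A\setminus\{0\}\ne\emptyset$, $Q\setminus\{0\}\neq\emptyset$. The revenue $R:Q\to\mathbb R_+$ is continuous with $R(0)=0$. The production cost $C:A\to\mathbb R_+$ is continuous and non-decreasing; if $A$ is unbounded, then additionally $C(\alpha)/\alpha\to+\infty$ as $A\ni\alpha\to+\infty$. The constant $\beta>0$ is fixed. Admissible strategies and value function. For $x\ge 0$, $\mathscr A(x)$ is the set of pairs of Borel measurable functions $\alpha:\mathbb R_+\to A$, $q:\mathbb R_+\to Q$ (with $\alpha$ locally integrable) such that $X_t=x+\int_0^t(\alpha_s-q_s)\,ds\ge 0$ for all $t\ge 0$. The value function is $$v(x)=\sup_{(\alpha,q)\in\mathscr A(x)}\int_0^\infty e^{-\beta t}(R(q_t)-C(\alpha_t))\,dt,\quad x\ge 0,$$ where the integral takes values in $[-\infty,\infty)$. Hamiltonian. For $z\in\mathbb R$, $$H(z)=\widehat R(z)+\widehat C(z),\quad \widehat R(z)=\sup_{q\in Q}\{R(q)-qz\},\quad \widehat C(z)=\sup_{\alpha\in A}\{\alpha z-C(\alpha)\}.$$ These functions are finite and convex on $\mathbb R$, so $H'$ exists outside an at most countable set. $\mathscr M_H=\arg\min_{z\in\mathbb R}H(z)$ is a non-empty closed convex subset of $\mathbb R_+$. Conventions. $v'(0)$ denotes the right derivative. A function $\psi$ on an interval $I$ is absolutely continuous if for every $\varepsilon>0$ there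 is $\delta>0$ such that $\sum_{i=1}^k|\psi(b_i)-\psi(a_i)|<\varepsilon$ for all finite families of disjoint intervals $(a_i,b_i)$ with $[a_i,b_i]\subset I$ and $\sum_{i=1}^k(b_i-a_i)<\delta$. "A.e." refers to Lebesgue measure. *)

theory Defs
  imports "HOL-Analysis.Analysis"
begin

text \<open>
  The time axis and the sets \<open>A\<close>, \<open>Q\<close> are subsets of the type \<^typ>\<open>real\<close>; the functions
  \<open>R\<close>, \<open>C\<close>, the controls and the value function are total, and only their values on
  \<open>Q\<close>, \<open>A\<close> and \<open>[0, \<infinity>)\<close> matter.
\<close>

definition state_path :: "real \<Rightarrow> (real \<Rightarrow> real) \<Rightarrow> (real \<Rightarrow> real) \<Rightarrow> real \<Rightarrow> real" where
  "state_path x \<alpha> q t = x + (LBINT s:{0..t}. \<alpha> s - q s)"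

definition admissible ::
    "real set \<Rightarrow> real set \<Rightarrow> real \<Rightarrow> ((real \<Rightarrow> real) \<times> (real \<Rightarrow> real)) set" where
  "admissible A Q x = {(\<alpha>, q).
     \<alpha> \<in> borel_measurable (restrict_space borel {0..}) \<and> (\<forall>t\<ge>0. \<alpha> t \<in> A) \<and>
     q \<in> borel_measurable (restrict_space borel {0..}) \<and> (\<forall>t\<ge>0. q t \<in> Q) \<and>
     (\<forall>t\<ge>0. set_integrable lborel {0..t} \<alpha>) \<and>
     (\<forall>t\<ge>0. state_path x \<alpha> q t \<ge> 0)}"

text \<open>
  The extended integral is the integral of the positive part minus that of the negative part;
  \<^const>\<open>ennreal\<close> truncates negative reals to \<open>0\<close>. It is used for integrands
  whose positive part has a finite integral, so that \<open>\<infinity> - \<infinity>\<close> does not occur.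
\<close>

definition extended_integral :: "real set \<Rightarrow> (real \<Rightarrow> real) \<Rightarrow> ereal" where
  "extended_integral S f =
     enn2ereal (\<integral>\<^sup>+t\<in>S. ennreal (f t) \<partial>lborel) - enn2ereal (\<integral>\<^sup>+t\<in>S. ennreal (- f t) \<partial>lborel)"

definition payoff ::
    "(real \<Rightarrow> real) \<Rightarrow> (real \<Rightarrow> real) \<Rightarrow> real \<Rightarrow> (real \<Rightarrow> real) \<Rightarrow> (real \<Rightarrow> real) \<Rightarrow> ereal" where
  "payoff R C \<beta> \<alpha> q = extended_integral {0..} (\<lambda>t. exp (- \<beta> * t) * (R (q t) - C (\<alpha> t)))"

definition value_function ::
    "real set \<Rightarrow> real set \<Rightarrow> (real \<Rightarrow> real) \<Rightarrow> (real \<Rightarrow> real) \<Rightarrow> real \<Rightarrow> real \<Rightarrow> ereal" where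
  "value_function A Q R C \<beta> x = (SUP (\<alpha>, q)\<in>admissible A Q x. payoff R C \<beta> \<alpha> q)"

definition revenue_conjugate :: "real set \<Rightarrow> (real \<Rightarrow> real) \<Rightarrow> real \<Rightarrow> real" where
  "revenue_conjugate Q R z = (SUP q\<in>Q. R q - q * z)"

definition cost_conjugate :: "real set \<Rightarrow> (real \<Rightarrow> real) \<Rightarrow> real \<Rightarrow> real" where
  "cost_conjugate A C z = (SUP a\<in>A. a * z - C a)"

definition hamiltonian ::
    "real set \<Rightarrow> real set \<Rightarrow> (real \<Rightarrow> real) \<Rightarrow> (real \<Rightarrow> real) \<Rightarrow> real \<Rightarrow> real" where
  "hamiltonian A Q R C z = revenue_conjugate Q R z + cost_conjugate A C z"

definition argmin_set :: "(real \<Rightarrow> real) \<Rightarrow> real set" where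
  "argmin_set H = {z. is_arg_min H (\<lambda>_. True) z}"

definition least_minimizer :: "(real \<Rightarrow> real) \<Rightarrow> real" where
  "least_minimizer H = (LEAST z. z \<in> argmin_set H)"

text \<open>
  \<^term>\<open>deriv H z\<close> is unspecified where \<open>H\<close> is not differentiable. For convex \<open>H\<close>
  these points form a countable set, which does not affect the integral.
\<close>

definition Psi :: "(real \<Rightarrow> real) \<Rightarrow> real \<Rightarrow> real \<Rightarrow> real" where
  "Psi H \<beta> s = - (LBINT z:{s..least_minimizer H}. deriv H z / (\<beta> * z))"

definition xi :: "(real \<Rightarrow> real) \<Rightarrow> real \<Rightarrow> real \<Rightarrow> real" where
  "xi H \<beta> x = (THE s. s \<in> {0<..least_minimizer H} \<and> x = Psi H \<beta> s)"

definition strictly_concave_on :: "real set \<Rightarrow> (real \<Rightarrow> real) \<Rightarrow> bool" where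
  "strictly_concave_on S f \<longleftrightarrow> convex S \<and>
     (\<forall>x\<in>S. \<forall>y\<in>S. \<forall>u. x \<noteq> y \<and> 0 < u \<and> u < 1 \<longrightarrow>
        (1 - u) * f x + u * f y < f ((1 - u) * x + u * y))"

text \<open>Not to be confused with absolute continuity of measures, \<^const>\<open>absolutely_continuous\<close>.\<close>

definition absolutely_continuous_fun_on :: "real set \<Rightarrow> (real \<Rightarrow> real) \<Rightarrow> bool" where
  "absolutely_continuous_fun_on I f \<longleftrightarrow>
     (\<forall>\<epsilon>>0. \<exists>\<delta>>0. \<forall>(k::nat) a b.
        (\<forall>i<k. a i < b i \<and> {a i..b i} \<subseteq> I) \<and>
        disjoint_family_on (\<lambda>i. {a i<..<b i}) {..<k} \<and>
        (\<Sum>i<k. b i - a i) < \<delta>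
        \<longrightarrow> (\<Sum>i<k. \<bar>f (b i) - f (a i)\<bar>) < \<epsilon>)"

end

theory Submission
  imports Defs
begin

text \<open>
  The proof is a duality argument. Write \<open>u = \<alpha> - q\<close> for the net production and let \<open>lam\<close> be any
  nonnegative nonincreasing discounted price of the stock. The definition of \<open>H\<close> gives
  \<open>exp (- \<beta> t) (R (q t) - C (\<alpha> t)) \<le> exp (- \<beta> t) H (exp (\<beta> t) lam t) - lam t * u t\<close>, and because the
  stock stays nonnegative, the second mean value theorem gives \<open>\<integral> lam u \<ge> - lam 0 * x\<close>. Hence every
  such price bounds the value (\<open>payoff_le\<close>). For \<open>p\<close> in \<open>[0, \<zeta>]\<close> the price that starts at \<open>p\<close>, grows at
  rate \<open>\<beta>\<close> and is stopped at \<open>\<zeta>\<close> yields \<open>v x \<le> G p + p x\<close>, where \<open>G p\<close> is the discounted integral of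
  \<open>H\<close> along this price (\<open>value_le_dual_value\<close>).

  Both inequalities become equalities for rates that are optimal at the current price and exhaust
  the stock when the price reaches \<open>\<zeta>\<close>. Along them the stock at price \<open>s\<close> equals \<open>\<Psi> s\<close>, so the initial
  stock must be \<open>\<Psi> p\<close>. From then on the stock has to be kept near \<open>0\<close> by rates that are optimal at
  \<open>\<zeta>\<close>. As \<open>\<zeta>\<close> minimises \<open>H\<close>, there are such rates with \<open>u \<ge> 0\<close> and others with \<open>u \<le> 0\<close>, and rapid
  switching between them loses arbitrarily little. This gives \<open>v (\<Psi> p) = G p + p * \<Psi> p\<close>
  (\<open>value_ge_dual_value\<close>).

  The integral \<open>G\<close> is identified without computing it. The two bounds together say that \<open>- \<Psi> p\<close> is a
  subgradient of \<open>G\<close> at \<open>p\<close>; so \<open>G p + p * \<Psi> p\<close> has derivative \<open>p * \<Psi>' p = H' p / \<beta>\<close>, and comparing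
  the values at \<open>\<zeta>\<close> gives \<open>v (\<Psi> p) = H p / \<beta>\<close> (\<open>dual_value_eq\<close>). The bound \<open>v y \<le> G p + p y\<close> is affine
  in \<open>y\<close> and touches \<open>v\<close> at \<open>\<Psi> p\<close>, so the inverse \<open>\<xi>\<close> of \<open>\<Psi>\<close> is a supergradient of \<open>v\<close>. The integral
  formula, strict monotonicity and strict concavity of \<open>v\<close>, and \<open>v' = \<xi>\<close> all follow from this and from
  the strict monotonicity and continuity of \<open>\<xi>\<close>.

  Since \<open>H\<close> may have countably many kinks, everything is phrased with monotone selections of
  subgradients. Two functions with the same monotone subgradient differ by a constant
  (\<open>subgradient_on_unique\<close>), which takes the place of the fundamental theorem of calculus.
\<close>

section \<open>Subgradients of convex functions of one variable\<close>

definition subgradient_on :: "real set \<Rightarrow> (real \<Rightarrow> real) \<Rightarrow> (real \<Rightarrow> real) \<Rightarrow> bool" where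
  "subgradient_on S F m \<longleftrightarrow> (\<forall>x\<in>S. \<forall>y\<in>S. F x + m x * (y - x) \<le> F y)"

lemma subgradient_onD:
  "subgradient_on S F m \<Longrightarrow> x \<in> S \<Longrightarrow> y \<in> S \<Longrightarrow> F x + m x * (y - x) \<le> F y"
  by (auto simp: subgradient_on_def)

lemma subgradient_on_subset: "subgradient_on S F m \<Longrightarrow> T \<subseteq> S \<Longrightarrow> subgradient_on T F m"
  by (auto simp: subgradient_on_def)

lemma subgradient_on_mono:
  assumes "subgradient_on S F m"
  shows "mono_on S m"
proof (rule mono_onI)
  fix x y assume xy: "x \<in> S" "y \<in> S" "x \<le> y"
  have "m x * (y - x) \<le> m y * (y - x)"
    using subgradient_onD[OF assms xy(1,2)] subgradient_onD[OF assms xy(2,1)] by (simp add: algebra_simps)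
  then show "m x \<le> m y"
    using xy by (cases "x = y") auto
qed

lemma subgradient_on_has_derivative:
  assumes sub: "subgradient_on S F m" and x: "x \<in> S" and cont: "continuous (at x within S) m"
  shows "(F has_real_derivative m x) (at x within S)"
proof -
  have lim: "((\<lambda>y. m y) \<longlongrightarrow> m x) (at x within S)"
    using cont by (simp add: continuous_within)
  have "((\<lambda>y. (F y - F x) / (y - x) - m x) \<longlongrightarrow> 0) (at x within S)"
  proof (rule Lim_null_comparison)
    show "\<forall>\<^sub>F y in at x within S. norm ((F y - F x) / (y - x) - m x) \<le> \<bar>m y - m x\<bar>"
      unfolding eventually_at_filter
    proof (intro always_eventually allI impI)
      fix y assume y: "y \<noteq> x" "y \<in> S"
      have a: "F x + m x * (y - x) \<le> F y" and b: "F y + m y * (x - y) \<le> F x"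
        using subgradient_onD[OF sub] x y by auto
      have eq: "(F y - F x) / (y - x) - m x = (F y - F x - m x * (y - x)) / (y - x)"
        using y by (simp add: field_simps)
      have "\<bar>F y - F x - m x * (y - x)\<bar> \<le> (m y - m x) * (y - x)"
        using a b by (simp add: algebra_simps)
      also have "\<dots> \<le> \<bar>m y - m x\<bar> * \<bar>y - x\<bar>"
        by (metis abs_ge_self abs_mult)
      finally show "norm ((F y - F x) / (y - x) - m x) \<le> \<bar>m y - m x\<bar>"
        unfolding eq using y by (simp add: abs_divide divide_simps)
    qed
    show "((\<lambda>y. \<bar>m y - m x\<bar>) \<longlongrightarrow> 0) (at x within S)"
      using lim by (simp add: LIM_zero_iff tendsto_rabs_zero_iff)
  qed
  then show ?thesis
    by (simp add: has_field_derivative_iff LIM_zero_iff)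
qed

text \<open>
  A monotone subgradient may jump at countably many points, and there the functions to be compared
  are not differentiable. Summing the hypothesis over a partition into \<open>n\<close> equal parts bounds
  \<open>\<bar>D b - D a\<bar>\<close> by \<open>(M b - M a) * (b - a) / n\<close>, so the jumps do not matter.
\<close>

lemma eq_if_increments_le_mono:
  fixes D M :: "real \<Rightarrow> real"
  assumes "a \<le> b"
    and inc: "\<And>x y. a \<le> x \<Longrightarrow> x \<le> y \<Longrightarrow> y \<le> b \<Longrightarrow> \<bar>D y - D x\<bar> \<le> (M y - M x) * (y - x)"
  shows "D a = D b"
proof -
  define K where "K = (M b - M a) * (b - a)"
  have bound: "\<bar>D b - D a\<bar> \<le> K / real n" if n: "n > 0" for n :: nat
  proof -
    define p where "p i = a + real i * ((b - a) / n)" for i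
    have p0: "p 0 = a" and pn: "p n = b" using n by (auto simp: p_def)
    have step: "p (Suc i) - p i = (b - a) / n" for i
      by (simp add: p_def distrib_right add_divide_distrib)
    have nn: "0 \<le> (b - a) / n" using assms(1) by simp
    have pin: "a \<le> p i" "p i \<le> p (Suc i)" for i
      using mult_nonneg_nonneg[OF of_nat_0_le_iff nn, of i] step[of i] nn by (auto simp only: p_def)
    have mp: "p i \<le> p j" if "i \<le> j" for i j
      using lift_Suc_mono_le[of p, OF pin(2) that] by simp
    have "\<bar>D b - D a\<bar> = \<bar>\<Sum>i<n. D (p (Suc i)) - D (p i)\<bar>"
      using sum_lessThan_telescope[of "\<lambda>i. D (p i)" n] by (simp add: p0 pn)
    also have "\<dots> \<le> (\<Sum>i<n. \<bar>D (p (Suc i)) - D (p i)\<bar>)" by (rule sum_abs)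
    also have "\<dots> \<le> (\<Sum>i<n. (M (p (Suc i)) - M (p i)) * ((b - a) / n))"
    proof (rule sum_mono)
      fix i assume i: "i \<in> {..<n}"
      then have "p (Suc i) \<le> b" using mp[of "Suc i" n] pn by auto
      then show "\<bar>D (p (Suc i)) - D (p i)\<bar> \<le> (M (p (Suc i)) - M (p i)) * ((b - a) / n)"
        using inc[of "p i" "p (Suc i)"] pin[of i] step[of i] by simp
    qed
    also have "\<dots> = (M b - M a) * ((b - a) / n)"
      using sum_lessThan_telescope[of "\<lambda>i. M (p i)" n]
      by (simp add: sum_distrib_right[symmetric] sum_divide_distrib[symmetric] p0 pn)
    finally show ?thesis by (simp add: K_def)
  qed
  have "\<bar>D b - D a\<bar> \<le> 0"
  proof (rule LIMSEQ_le_const)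
    show "(\<lambda>n. K / real n) \<longlonglongrightarrow> 0" by (rule lim_const_over_n)
    show "\<exists>N. \<forall>n\<ge>N. \<bar>D b - D a\<bar> \<le> K / real n" using bound by (intro exI[of _ 1]) auto
  qed
  then show ?thesis by simp
qed

lemma LBINT_point:
  fixes f :: "real \<Rightarrow> real"
  shows "(LBINT t:{a}. f t) = 0"
proof -
  have "(LBINT t. indicator {a} t *\<^sub>R f t) = (LBINT t::real. 0::real)"
  proof (rule integral_discrete_difference)
    show "countable {a}" by simp
  qed auto
  then show ?thesis by (simp add: set_lebesgue_integral_def)
qed

lemma set_integrable_mono_on:
  fixes m :: "real \<Rightarrow> real"
  assumes "mono_on {a..b} m"
  shows "set_integrable lborel {a..b} m"
proof -
  have meas: "set_borel_measurable lborel {a..b} m"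
    using borel_measurable_mono_on_fnc[OF assms]
    by (simp add: set_borel_measurable_def borel_measurable_restrict_space_iff)
  show ?thesis
  proof (cases "a \<le> b")
    case True
    show ?thesis
    proof (rule set_integrable_bound[of lborel "{a..b}" "\<lambda>_. \<bar>m a\<bar> + \<bar>m b\<bar>"])
      have "m a \<le> m x" "m x \<le> m b" if "x \<in> {a..b}" for x
        using that mono_onD[OF assms, of a x] mono_onD[OF assms, of x b] by auto
      then show "AE x in lborel. x \<in> {a..b} \<longrightarrow> norm (m x) \<le> norm (\<bar>m a\<bar> + \<bar>m b\<bar>)"
        by (intro always_eventually) (force simp: abs_real_def)
    qed (use meas in \<open>auto simp: set_integrable_def emeasure_lborel_Icc_eq intro!: integrable_real_indicator\<close>)
  qed (simp add: set_integrable_def)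
qed

lemma set_integral_split:
  fixes f :: "real \<Rightarrow> real"
  assumes "a \<le> c" "c \<le> b" "set_integrable lborel {a..b} f"
  shows "(LBINT z:{a..b}. f z) = (LBINT z:{a..c}. f z) + (LBINT z:{c..b}. f z)"
proof -
  have "set_integrable lborel {a..c} f" "set_integrable lborel {c..b} f"
    using assms by (auto intro: set_integrable_subset)
  then show ?thesis
    using assms Henstock_Kurzweil_Integration.integral_combine[of a c b f]
    by (simp add: set_borel_integral_eq_integral)
qed

lemma mono_integral_bounds:
  fixes m :: "real \<Rightarrow> real"
  assumes "mono_on {a..b} m" "a \<le> b"
  shows "m a * (b - a) \<le> (LBINT z:{a..b}. m z)" "(LBINT z:{a..b}. m z) \<le> m b * (b - a)"
proof -
  have int: "m integrable_on {a..b}" "(LBINT z:{a..b}. m z) = integral {a..b} m"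
    using set_borel_integral_eq_integral[OF set_integrable_mono_on[OF assms(1)]] by auto
  have const: "integral {a..b} (\<lambda>_. k) = k * (b - a)" for k :: real
    using assms(2) by simp
  have "integral {a..b} (\<lambda>_. m a) \<le> integral {a..b} m"
    by (rule integral_le) (use int assms(2) in \<open>auto intro: mono_onD[OF assms(1)]\<close>)
  then show "m a * (b - a) \<le> (LBINT z:{a..b}. m z)"
    unfolding const int(2) .
  have "integral {a..b} m \<le> integral {a..b} (\<lambda>_. m b)"
    by (rule integral_le) (use int assms(2) in \<open>auto intro: mono_onD[OF assms(1)]\<close>)
  then show "(LBINT z:{a..b}. m z) \<le> m b * (b - a)"
    unfolding const int(2) .
qed

lemma subgradient_on_integral:
  fixes m :: "real \<Rightarrow> real"
  assumes mono: "mono_on {a..b} m"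
  shows "subgradient_on {a..b} (\<lambda>x. - (LBINT z:{x..b}. m z)) m"
  unfolding subgradient_on_def
proof (intro ballI)
  fix x y assume xy: "x \<in> {a..b}" "y \<in> {a..b}"
  have *: "(LBINT z:{x..b}. m z) = (LBINT z:{x..y}. m z) + (LBINT z:{y..b}. m z)"
    "m x * (y - x) \<le> (LBINT z:{x..y}. m z)" "(LBINT z:{x..y}. m z) \<le> m y * (y - x)"
    if "x \<le> y" "x \<in> {a..b}" "y \<in> {a..b}" for x y
  proof -
    have "mono_on {x..b} m" "mono_on {x..y} m" using that by (auto intro: mono_on_subset[OF mono])
    then show "(LBINT z:{x..b}. m z) = (LBINT z:{x..y}. m z) + (LBINT z:{y..b}. m z)"
      "m x * (y - x) \<le> (LBINT z:{x..y}. m z)" "(LBINT z:{x..y}. m z) \<le> m y * (y - x)"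
      using that by (auto intro!: set_integral_split set_integrable_mono_on mono_integral_bounds)
  qed
  show "- (LBINT z:{x..b}. m z) + m x * (y - x) \<le> - (LBINT z:{y..b}. m z)"
  proof (cases "x \<le> y")
    case True
    then show ?thesis using *[of x y] xy by simp
  next
    case False
    then show ?thesis using *[of y x] xy by (simp add: algebra_simps)
  qed
qed

lemma subgradient_increment_bounds:
  assumes "subgradient_on S F m" "x \<in> S" "y \<in> S"
  shows "m x * (y - x) \<le> F y - F x" "F y - F x \<le> m y * (y - x)"
  using subgradient_onD[OF assms] subgradient_onD[OF assms(1,3,2)] by (auto simp: algebra_simps)

lemma subgradient_on_unique:
  assumes "subgradient_on {a..b} F m" "subgradient_on {a..b} G m" "a \<le> b"
  shows "F b - F a = G b - G a"
proof -
  have "F a - G a = F b - G b"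
  proof (rule eq_if_increments_le_mono[OF assms(3), where M = m])
    fix x y assume xy: "a \<le> x" "x \<le> y" "y \<le> b"
    show "\<bar>F y - G y - (F x - G x)\<bar> \<le> (m y - m x) * (y - x)"
      using subgradient_increment_bounds[OF assms(1), of x y]
        subgradient_increment_bounds[OF assms(2), of x y] xy
      by (auto simp: algebra_simps abs_le_iff)
  qed
  then show ?thesis by simp
qed

lemma subgradient_on_integral_eq:
  assumes "subgradient_on {a..b} F m" "a \<le> b"
  shows "(LBINT z:{a..b}. m z) = F b - F a"
proof -
  show ?thesis
    using subgradient_on_unique[OF assms(1) subgradient_on_integral[OF subgradient_on_mono[OF assms(1)]] assms(2)]
    by (simp add: LBINT_point)
qed

lemma set_integrable_antimono_weight:
  fixes lam u :: "real \<Rightarrow> real"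
  assumes u: "set_integrable lborel {a..b} u" and anti: "antimono_on {a..b} lam"
  shows "set_integrable lborel {a..b} (\<lambda>t. lam t * u t)"
proof (cases "a \<le> b")
  case True
  have mono: "mono_on {a..b} (\<lambda>t. - lam t)"
    using anti by (auto simp: monotone_on_def)
  then have "set_integrable lborel {a..b} (\<lambda>t. - lam t)"
    by (rule set_integrable_mono_on)
  then have meas: "(\<lambda>t. indicator {a..b} t * lam t) \<in> borel_measurable lborel"
    by (simp add: set_integrable_def)
  have "integrable lborel (\<lambda>t. (indicator {a..b} t * lam t) * (indicator {a..b} t * u t))"
  proof (rule Bochner_Integration.integrable_bound[of lborel "\<lambda>t. (\<bar>lam a\<bar> + \<bar>lam b\<bar>) * (indicator {a..b} t * u t)"])
    show "integrable lborel (\<lambda>t. (\<bar>lam a\<bar> + \<bar>lam b\<bar>) * (indicator {a..b} t * u t))"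
      using u by (simp add: set_integrable_def)
    show "(\<lambda>t. (indicator {a..b} t * lam t) * (indicator {a..b} t * u t)) \<in> borel_measurable lborel"
      using meas u by (auto simp: set_integrable_def intro!: borel_measurable_times)
    have "\<bar>lam t\<bar> \<le> \<bar>lam a\<bar> + \<bar>lam b\<bar>" if "t \<in> {a..b}" for t
      using that monotone_onD[OF anti, of a t] monotone_onD[OF anti, of t b] by auto
    then have "\<bar>lam t\<bar> * \<bar>u t\<bar> \<le> (\<bar>lam a\<bar> + \<bar>lam b\<bar>) * \<bar>u t\<bar>" if "t \<in> {a..b}" for t
      using that by (intro mult_right_mono) auto
    then show "AE t in lborel. norm ((indicator {a..b} t * lam t) * (indicator {a..b} t * u t))
        \<le> norm ((\<bar>lam a\<bar> + \<bar>lam b\<bar>) * (indicator {a..b} t * u t))"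
      by (intro always_eventually) (auto simp: indicator_def abs_mult)
  qed
  then show ?thesis
    unfolding set_integrable_def
    by (rule Bochner_Integration.integrable_cong[THEN iffD1, rotated -1]) (auto simp: indicator_def)
qed (simp add: set_integrable_def)

text \<open>
  The second mean value theorem writes the weighted integral as
  \<open>(lam a - lam b) * U c + lam b * U b\<close>, where \<open>U\<close> is the primitive of \<open>u\<close>. In the control problem
  \<open>U\<close> is the change of the state and \<open>lam\<close> a discounted price, so a one-sided bound on the state
  becomes a bound on the discounted value of the net production.
\<close>

lemma antimono_weight_integral_bounds:
  fixes lam u :: "real \<Rightarrow> real"
  assumes u: "set_integrable lborel {a..b} u" and anti: "antimono_on {a..b} lam"
    and ab: "a \<le> b" and nn: "0 \<le> lam b"
  shows "(\<And>t. t \<in> {a..b} \<Longrightarrow> L \<le> (LBINT s:{a..t}. u s)) \<Longrightarrow> lam a * L \<le> (LBINT s:{a..b}. lam s * u s)"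
    and "(\<And>t. t \<in> {a..b} \<Longrightarrow> (LBINT s:{a..t}. u s) \<le> L) \<Longrightarrow> (LBINT s:{a..b}. lam s * u s) \<le> lam a * L"
proof -
  let ?U = "\<lambda>t. LBINT s:{a..t}. u s"
  have ui: "u integrable_on {a..b}" using set_borel_integral_eq_integral[OF u] by simp
  obtain c where c: "c \<in> {a..b}"
    and eq: "integral {a..b} (\<lambda>x. - lam x * u x) = - lam a * integral {a..c} u + - lam b * integral {c..b} u"
    using second_mean_value_theorem[OF ui ab, of "\<lambda>x. - lam x"] anti by (auto simp: monotone_on_def)
  have i1: "?U c = integral {a..c} u" "?U b = integral {a..b} u"
    using c ab u by (auto intro!: set_borel_integral_eq_integral(2) intro: set_integrable_subset)
  have i2: "integral {a..c} u + integral {c..b} u = integral {a..b} u"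
    using Henstock_Kurzweil_Integration.integral_combine[of a c b u] c ui by auto
  have "(LBINT s:{a..b}. lam s * u s) = integral {a..b} (\<lambda>x. lam x * u x)"
    by (rule set_borel_integral_eq_integral(2)[OF set_integrable_antimono_weight[OF u anti]])
  then have *: "(LBINT s:{a..b}. lam s * u s) = (lam a - lam b) * ?U c + lam b * ?U b"
    using eq i1 i2[symmetric] by (simp add: algebra_simps)
  have le: "lam b \<le> lam a" using monotone_onD[OF anti, of a b] ab by simp
  show "lam a * L \<le> (LBINT s:{a..b}. lam s * u s)" if "\<And>t. t \<in> {a..b} \<Longrightarrow> L \<le> ?U t"
  proof -
    have "(lam a - lam b) * L + lam b * L \<le> (lam a - lam b) * ?U c + lam b * ?U b"
      using that c ab le nn by (intro add_mono mult_left_mono) auto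
    then show ?thesis using * by (simp add: algebra_simps)
  qed
  show "(LBINT s:{a..b}. lam s * u s) \<le> lam a * L" if "\<And>t. t \<in> {a..b} \<Longrightarrow> ?U t \<le> L"
  proof -
    have "(lam a - lam b) * ?U c + lam b * ?U b \<le> (lam a - lam b) * L + lam b * L"
      using that c ab le nn by (intro add_mono mult_left_mono) auto
    then show ?thesis using * by (simp add: algebra_simps)
  qed
qed

section \<open>Absolute continuity of a monotone function\<close>

text \<open>
  The images of disjoint intervals under a nonincreasing function overlap in endpoints at most, so
  their total length is at most the length of the range.
\<close>

lemma sum_decrements_le:
  fixes F a b :: "_ \<Rightarrow> real" and k :: nat
  assumes anti: "antimono_on {0..} F" and low: "\<And>x. 0 \<le> x \<Longrightarrow> m \<le> F x"
    and ab: "\<And>i. i < k \<Longrightarrow> 0 \<le> a i \<and> a i < b i"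
    and disj: "disjoint_family_on (\<lambda>i. {a i<..<b i}) {..<k}"
  shows "(\<Sum>i<k. F (a i) - F (b i)) \<le> F 0 - m"
proof -
  let ?I = "\<lambda>i. {F (b i)<..<F (a i)}"
  have le: "F y \<le> F x" if "0 \<le> x" "x \<le> y" for x y
    using monotone_onD[OF anti, of x y] that by auto
  have dec: "F (b i) \<le> F (a i)" if "i < k" for i using ab[OF that] by (intro le) auto
  have dj: "disjoint_family_on ?I {..<k}"
    unfolding disjoint_family_on_def
  proof (intro ballI impI)
    fix i j assume ij: "i \<in> {..<k}" "j \<in> {..<k}" "i \<noteq> j"
    then have "{a i<..<b i} \<inter> {a j<..<b j} = {}"
      using disj by (auto simp: disjoint_family_on_def)
    \<comment> \<open>If the two intervals overlapped, the midpoint of the overlap would lie in both.\<close>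
    moreover have "(max (a i) (a j) + min (b i) (b j)) / 2 \<in> {a i<..<b i} \<inter> {a j<..<b j}"
      if "max (a i) (a j) < min (b i) (b j)" using that by (auto simp: max_def min_def split: if_splits)
    ultimately have "min (b i) (b j) \<le> max (a i) (a j)" by fastforce
    then have "b i \<le> a j \<or> b j \<le> a i" using ab[of i] ab[of j] ij by (auto simp: max_def min_def split: if_splits)
    then show "?I i \<inter> ?I j = {}"
    proof
      assume "b i \<le> a j"
      then have "F (a j) \<le> F (b i)" using ab[of i] ij by (intro le) auto
      then show ?thesis by auto
    next
      assume "b j \<le> a i"
      then have "F (a i) \<le> F (b j)" using ab[of j] ij by (intro le) auto
      then show ?thesis by auto
    qed
  qed
  have "(\<Sum>i<k. F (a i) - F (b i)) = (\<Sum>i<k. measure lborel (?I i))"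
    using dec by (intro sum.cong) auto
  also have "\<dots> = measure lborel (\<Union>i<k. ?I i)"
    by (rule measure_finite_Union[symmetric]) (use dj dec in auto)
  also have "\<dots> \<le> measure lborel {m..F 0}"
  proof (rule measure_mono_fmeasurable)
    show "(\<Union>i<k. ?I i) \<subseteq> {m..F 0}"
    proof
      fix y assume "y \<in> (\<Union>i<k. ?I i)"
      then obtain i where i: "i < k" "F (b i) < y" "y < F (a i)" by auto
      moreover have "m \<le> F (b i)" "F (a i) \<le> F 0" using ab[OF i(1)] low le by auto
      ultimately show "y \<in> {m..F 0}" by auto
    qed
    show "{m..F 0} \<in> fmeasurable lborel" by (rule fmeasurable_compact) simp
  qed auto
  also have "\<dots> = F 0 - m" using low[of 0] by simp
  finally show ?thesis .
qed

text \<open>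
  The increments are split at a point \<open>\<eta>\<close> near \<open>0\<close>: left of it the total variation is small, and right
  of it the Lipschitz bound applies.
\<close>

lemma absolutely_continuous_antimono:
  fixes g :: "real \<Rightarrow> real"
  assumes anti: "antimono_on {0..} g" and cont: "continuous (at 0 within {0..}) g"
    and lip: "\<And>\<eta>. 0 < \<eta> \<Longrightarrow> \<exists>L\<ge>0. \<forall>x\<ge>\<eta>. \<forall>y\<ge>x. g x - g y \<le> L * (y - x)"
  shows "absolutely_continuous_fun_on {0..} g"
  unfolding absolutely_continuous_fun_on_def
proof (intro allI impI)
  fix \<epsilon> :: real assume \<epsilon>: "0 < \<epsilon>"
  obtain d where d: "0 < d" "\<And>y. 0 \<le> y \<Longrightarrow> dist y 0 < d \<Longrightarrow> dist (g y) (g 0) < \<epsilon> / 2"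
    using cont \<epsilon> unfolding continuous_within_eps_delta by (metis atLeast_iff half_gt_zero)
  define \<eta> where "\<eta> = d / 2"
  have "dist (g \<eta>) (g 0) < \<epsilon> / 2" using d(1) d(2)[of \<eta>] by (simp add: \<eta>_def dist_real_def)
  then have \<eta>: "0 < \<eta>" "g 0 - g \<eta> < \<epsilon> / 2" using d(1) unfolding \<eta>_def dist_real_def by linarith+
  obtain L where L: "0 \<le> L" "\<And>x y. \<eta> \<le> x \<Longrightarrow> x \<le> y \<Longrightarrow> g x - g y \<le> L * (y - x)"
    using lip[OF \<eta>(1)] by blast
  define \<delta> where "\<delta> = \<epsilon> / (2 * (L + 1))"
  have le: "g y \<le> g x" if "0 \<le> x" "x \<le> y" for x y
    using monotone_onD[OF anti, of x y] that by auto
  let ?F = "\<lambda>x. g (min x \<eta>)"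
  have split: "\<bar>g y - g x\<bar> \<le> (?F x - ?F y) + L * (y - x)" if "0 \<le> x" "x < y" for x y
  proof -
    have abs: "\<bar>g y - g x\<bar> = g x - g y" using le[of x y] that by simp
    have nn: "0 \<le> L * (y - x)" using L(1) that by simp
    consider "y \<le> \<eta>" | "\<eta> \<le> x" | "x < \<eta>" "\<eta> < y" by linarith
    then show ?thesis
    proof cases
      case 1
      then show ?thesis using abs nn that by simp
    next
      case 2
      then show ?thesis using abs L(2)[of x y] that by simp
    next
      case 3
      have "L * (y - \<eta>) \<le> L * (y - x)" using 3 L(1) by (intro mult_left_mono) auto
      then show ?thesis using abs L(2)[of \<eta> y] 3 by simp
    qed
  qed
  show "\<exists>\<delta>>0. \<forall>(k::nat) a b.
        (\<forall>i<k. a i < b i \<and> {a i..b i} \<subseteq> {0..}) \<and>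
        disjoint_family_on (\<lambda>i. {a i<..<b i}) {..<k} \<and>
        (\<Sum>i<k. b i - a i) < \<delta>
        \<longrightarrow> (\<Sum>i<k. \<bar>g (b i) - g (a i)\<bar>) < \<epsilon>"
  proof (intro exI[of _ \<delta>] conjI allI impI)
    show "0 < \<delta>" using \<epsilon> L(1) by (simp add: \<delta>_def)
    fix k :: nat and a b :: "nat \<Rightarrow> real"
    assume *: "(\<forall>i<k. a i < b i \<and> {a i..b i} \<subseteq> {0..}) \<and>
        disjoint_family_on (\<lambda>i. {a i<..<b i}) {..<k} \<and> (\<Sum>i<k. b i - a i) < \<delta>"
    have ab: "0 \<le> a i \<and> a i < b i" if "i < k" for i
    proof -
      have "a i < b i" "{a i..b i} \<subseteq> {0..}" using * that by auto
      then show ?thesis by auto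
    qed
    have "(\<Sum>i<k. \<bar>g (b i) - g (a i)\<bar>) \<le> (\<Sum>i<k. (?F (a i) - ?F (b i)) + L * (b i - a i))"
      using ab by (intro sum_mono split) auto
    also have "\<dots> = (\<Sum>i<k. ?F (a i) - ?F (b i)) + L * (\<Sum>i<k. b i - a i)"
      by (simp add: sum.distrib sum_distrib_left)
    also have "\<dots> \<le> (?F 0 - g \<eta>) + L * \<delta>"
    proof (intro add_mono mult_left_mono L(1))
      show "(\<Sum>i<k. ?F (a i) - ?F (b i)) \<le> ?F 0 - g \<eta>"
      proof (rule sum_decrements_le[OF _ _ ab])
        show "antimono_on {0..} ?F"
          using \<eta>(1) by (intro monotone_onI le) auto
        show "g \<eta> \<le> ?F x" if "0 \<le> x" for x using that \<eta>(1) by (intro le) auto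
      qed (use * in auto)
    qed (use * in auto)
    also have "\<dots> < \<epsilon>"
    proof -
      have "L * \<delta> \<le> \<epsilon> / 2" using L(1) \<epsilon> by (simp add: \<delta>_def field_simps)
      then show ?thesis using \<eta> by simp
    qed
    finally show "(\<Sum>i<k. \<bar>g (b i) - g (a i)\<bar>) < \<epsilon>" .
  qed
qed

section \<open>Integrals over the half-line\<close>

lemma set_integrable_exp_minus:
  assumes "0 < \<beta>"
  shows "set_integrable lborel {0..} (\<lambda>t::real. exp (- \<beta> * t))"
    and "(LBINT t:{0..}. exp (- \<beta> * t)) = 1 / \<beta>"
proof -
  have "(\<lambda>t::real. exp (- \<beta> * t)) absolutely_integrable_on {0..}"
    using has_integral_exp_minus_to_infinity[OF assms, of 0]
    by (intro nonnegative_absolutely_integrable_1) (auto simp: integrable_on_def)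
  then show int: "set_integrable lborel {0..} (\<lambda>t::real. exp (- \<beta> * t))"
    unfolding set_integrable_def by (subst (asm) integrable_completion) auto
  show "(LBINT t:{0..}. exp (- \<beta> * t)) = 1 / \<beta>"
    using set_borel_integral_eq_integral(2)[OF int] has_integral_exp_minus_to_infinity[OF assms, of 0]
    by (simp add: integral_unique)
qed

lemma set_integrable_discounted:
  fixes f :: "real \<Rightarrow> real"
  assumes "0 < \<beta>" "set_borel_measurable lborel {0..} f" "\<And>t. 0 \<le> t \<Longrightarrow> \<bar>f t\<bar> \<le> K * exp (- \<beta> * t)"
  shows "set_integrable lborel {0..} f"
proof (rule set_integrable_bound[of lborel "{0..}" "\<lambda>t. K * exp (- \<beta> * t)"])
  show "set_integrable lborel {0..} (\<lambda>t. K * exp (- \<beta> * t))"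
    using set_integrable_exp_minus(1)[OF assms(1)] by simp
  have "norm (f t) \<le> norm (K * exp (- \<beta> * t))" if "0 \<le> t" for t
    using assms(3)[OF that] by (auto intro: order_trans)
  then show "AE t in lborel. t \<in> {0..} \<longrightarrow> norm (f t) \<le> norm (K * exp (- \<beta> * t))"
    by (intro always_eventually) auto
qed (use assms in auto)

lemma extended_integral_eq:
  assumes "set_integrable lborel S f"
  shows "extended_integral S f = ereal (LBINT t:S. f t)"
proof -
  let ?f = "\<lambda>t. indicator S t * f t"
  have int: "integrable lborel ?f" using assms by (simp add: set_integrable_def)
  have eq: "(\<integral>\<^sup>+t\<in>S. ennreal (f t) \<partial>lborel) = (\<integral>\<^sup>+t. ennreal (?f t) \<partial>lborel)"
    "(\<integral>\<^sup>+t\<in>S. ennreal (- f t) \<partial>lborel) = (\<integral>\<^sup>+t. ennreal (- ?f t) \<partial>lborel)"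
    by (auto intro!: nn_integral_cong simp: indicator_def)
  obtain p where p: "(\<integral>\<^sup>+t. ennreal (?f t) \<partial>lborel) = ennreal p" "0 \<le> p"
    using integrableD(2)[OF int] by (cases "\<integral>\<^sup>+t. ennreal (?f t) \<partial>lborel") auto
  obtain n where n: "(\<integral>\<^sup>+t. ennreal (- ?f t) \<partial>lborel) = ennreal n" "0 \<le> n"
    using integrableD(3)[OF int] by (cases "\<integral>\<^sup>+t. ennreal (- ?f t) \<partial>lborel") auto
  have "(LBINT t:S. f t) = p - n"
    using real_lebesgue_integral_def[OF int] p n by (simp add: set_lebesgue_integral_def)
  then show ?thesis
    unfolding extended_integral_def eq using p n by simp
qed

lemma extended_integral_le:
  assumes meas: "set_borel_measurable lborel S f" and g: "set_integrable lborel S g"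
    and le: "\<And>t. t \<in> S \<Longrightarrow> f t \<le> g t"
    and bound: "set_integrable lborel S f \<Longrightarrow> (LBINT t:S. f t) \<le> K"
  shows "extended_integral S f \<le> ereal K"
proof -
  let ?f = "\<lambda>t. indicator S t * f t" and ?g = "\<lambda>t. indicator S t * g t"
  have eq: "(\<integral>\<^sup>+t\<in>S. ennreal (f t) \<partial>lborel) = (\<integral>\<^sup>+t. ennreal (?f t) \<partial>lborel)"
    "(\<integral>\<^sup>+t\<in>S. ennreal (- f t) \<partial>lborel) = (\<integral>\<^sup>+t. ennreal (- ?f t) \<partial>lborel)"
    by (auto intro!: nn_integral_cong simp: indicator_def)
  have gi: "integrable lborel ?g" using g by (simp add: set_integrable_def)
  have "(\<integral>\<^sup>+t. ennreal (?f t) \<partial>lborel) \<le> (\<integral>\<^sup>+t. ennreal (?g t) \<partial>lborel)"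
    by (intro nn_integral_mono ennreal_leI) (auto simp: indicator_def le)
  then have pos: "(\<integral>\<^sup>+t. ennreal (?f t) \<partial>lborel) \<noteq> \<infinity>"
    using integrableD(2)[OF gi] by (auto simp: top_unique)
  show ?thesis
  proof (cases "(\<integral>\<^sup>+t. ennreal (- ?f t) \<partial>lborel) = \<infinity>")
    case True
    then show ?thesis
      unfolding extended_integral_def eq using pos
      by (cases "\<integral>\<^sup>+t. ennreal (?f t) \<partial>lborel") (auto simp: enn2ereal_ennreal)
  next
    case False
    then have "set_integrable lborel S f"
      using pos meas by (simp add: set_integrable_def real_integrable_def set_borel_measurable_def)
    then show ?thesis using bound extended_integral_eq by simp
  qed
qed

lemma tendsto_LBINT_atLeast:
  fixes f :: "real \<Rightarrow> real"
  assumes "set_integrable lborel {0..} f"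
  shows "((\<lambda>T. LBINT t:{0..T}. f t) \<longlongrightarrow> (LBINT t:{0..}. f t)) at_top"
  by (rule tendsto_set_lebesgue_integral_at_top) (use assms in auto)

section \<open>Periodic switching\<close>

lemma set_integrable_bounded_Icc:
  fixes f :: "real \<Rightarrow> real"
  assumes [measurable]: "f \<in> borel_measurable borel" and "\<And>t. t \<in> {a..b} \<Longrightarrow> \<bar>f t\<bar> \<le> B"
  shows "set_integrable lborel {a..b} f"
proof (rule set_integrable_bound[of lborel "{a..b}" "\<lambda>_. B"])
  show "set_integrable lborel {a..b} (\<lambda>_. B)"
    by (auto simp: set_integrable_def emeasure_lborel_Icc_eq intro!: integrable_real_indicator)
  have "norm (f s) \<le> norm B" if "s \<in> {a..b}" for s using assms(2)[OF that] by auto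
  then show "AE s in lborel. s \<in> {a..b} \<longrightarrow> norm (f s) \<le> norm B" by (intro always_eventually) auto
  show "set_borel_measurable lborel {a..b} f" unfolding set_borel_measurable_def by measurable
qed

text \<open>
  Switching starts at time \<open>\<tau>\<close> with period \<open>\<delta>\<close>, and \<open>\<theta>\<close> is the fraction of each period spent at \<open>u1\<close>.
\<close>

definition switching :: "real \<Rightarrow> real \<Rightarrow> real \<Rightarrow> real \<Rightarrow> real \<Rightarrow> real \<Rightarrow> real" where
  "switching \<tau> \<delta> \<theta> u1 u2 t = (if frac ((t - \<tau>) / \<delta>) < \<theta> then u1 else u2)"

lemma measurable_switching [measurable]: "switching \<tau> \<delta> \<theta> u1 u2 \<in> borel_measurable borel"
  unfolding switching_def[abs_def] frac_def by measurable

lemma abs_switching_le: "\<bar>switching \<tau> \<delta> \<theta> u1 u2 t\<bar> \<le> \<bar>u1\<bar> + \<bar>u2\<bar>"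
  by (simp add: switching_def)

context
  fixes \<tau> \<delta> \<theta> u1 u2 :: real
  assumes \<delta>: "0 < \<delta>" and \<theta>: "0 \<le> \<theta>" "\<theta> \<le> 1" and u: "u2 \<le> 0" "0 \<le> u1" and mean: "\<theta> * u1 + (1 - \<theta>) * u2 = 0"
begin

lemma switching_within_period:
  fixes n :: nat
  assumes s: "\<tau> + n * \<delta> \<le> s" "s \<le> \<tau> + (n + 1) * \<delta>"
  shows "\<exists>I. (switching \<tau> \<delta> \<theta> u1 u2 has_integral I) {\<tau> + n * \<delta>..s} \<and> 0 \<le> I \<and> I \<le> \<delta> * u1
      \<and> (s = \<tau> + (n + 1) * \<delta> \<longrightarrow> I = 0)"
proof -
  let ?c = "switching \<tau> \<delta> \<theta> u1 u2"
  define a where "a = \<tau> + n * \<delta>"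
  define m where "m = min s (a + \<theta> * \<delta>)"
  have a: "a \<le> s" "s \<le> a + \<delta>" using s by (auto simp: a_def algebra_simps)
  have m: "a \<le> m" "m \<le> s" using a \<theta> \<delta> by (auto simp: m_def)
  have floor: "frac ((r - \<tau>) / \<delta>) = (r - a) / \<delta>" if "a < r" "r < s" for r
  proof -
    have "\<lfloor>(r - \<tau>) / \<delta>\<rfloor> = int n"
      using that a \<delta> by (intro floor_unique) (auto simp: a_def field_simps)
    then show ?thesis using \<delta> by (simp add: frac_def a_def field_simps)
  qed
  have "(?c has_integral (m - a) * u1) {a..m}"
  proof (rule has_integral_spike_finite[of "{a, m}"])
    show "((\<lambda>_. u1) has_integral (m - a) * u1) {a..m}" using has_integral_const_real[of u1 a m] m by simp
    fix r assume r: "r \<in> {a..m} - {a, m}"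
    then have "a < r" "r < s" "r - a < \<theta> * \<delta>" by (auto simp: m_def)
    then have "frac ((r - \<tau>) / \<delta>) < \<theta>" using floor[of r] \<delta> by (simp add: pos_divide_less_eq)
    then show "?c r = u1" by (simp add: switching_def)
  qed simp
  moreover have "(?c has_integral (s - m) * u2) {m..s}"
  proof (rule has_integral_spike_finite[of "{m, s}"])
    show "((\<lambda>_. u2) has_integral (s - m) * u2) {m..s}" using has_integral_const_real[of u2 m s] m by simp
    fix r assume r: "r \<in> {m..s} - {m, s}"
    then have "a < r" "r < s" "\<not> r - a < \<theta> * \<delta>" using m by (auto simp: m_def)
    then have "\<not> frac ((r - \<tau>) / \<delta>) < \<theta>" using floor[of r] \<delta> by (simp add: pos_divide_less_eq)
    then show "?c r = u2" by (simp add: switching_def)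
  qed simp
  ultimately have "(?c has_integral (m - a) * u1 + (s - m) * u2) {a..s}"
    by (rule has_integral_combine[OF m])
  moreover have "0 \<le> (m - a) * u1 + (s - m) * u2 \<and> (m - a) * u1 + (s - m) * u2 \<le> \<delta> * u1
      \<and> (s = a + \<delta> \<longrightarrow> (m - a) * u1 + (s - m) * u2 = 0)"
  proof -
    have mean': "(\<theta> * \<delta>) * u1 + (\<delta> - \<theta> * \<delta>) * u2 = 0"
      using arg_cong[OF mean, of "\<lambda>y. \<delta> * y"] by (simp add: algebra_simps)
    have td: "\<theta> * \<delta> \<le> \<delta>" using \<theta> \<delta> by simp
    show ?thesis
    proof (cases "s \<le> a + \<theta> * \<delta>")
      case True
      then have ms: "m = s" by (simp add: m_def)
      have "(s - a) * u1 \<le> \<delta> * u1" "0 \<le> (s - a) * u1" using a u by (auto intro: mult_right_mono)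
      moreover have "(s - a) * u1 = 0" if "s = a + \<delta>"
      proof -
        have "\<theta> * \<delta> = \<delta>" using that True td by simp
        then show ?thesis using mean' that by (simp only: diff_self mult_zero_left add_0_right add_diff_cancel_left')
      qed
      ultimately show ?thesis using ms by simp
    next
      case False
      then have ms: "m = a + \<theta> * \<delta>" by (simp add: m_def)
      have "(\<delta> - \<theta> * \<delta>) * u2 \<le> (s - m) * u2" using a u ms by (intro mult_right_mono_neg) auto
      moreover have "(s - m) * u2 \<le> 0" using m u by (simp add: mult_nonneg_nonpos)
      moreover have "(\<theta> * \<delta>) * u1 \<le> \<delta> * u1" by (rule mult_right_mono[OF td u(2)])
      moreover have "(m - a) * u1 = (\<theta> * \<delta>) * u1" using ms by simp
      moreover have "(s - m) * u2 = (\<delta> - \<theta> * \<delta>) * u2" if "s = a + \<delta>" using that ms by simp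
      ultimately show ?thesis using mean' by linarith
    qed
  qed
  ultimately show ?thesis unfolding a_def[symmetric] by (auto simp: a_def algebra_simps)
qed

lemma switching_whole_periods:
  fixes n :: nat
  shows "(switching \<tau> \<delta> \<theta> u1 u2 has_integral 0) {\<tau>..\<tau> + n * \<delta>}"
proof (induction n)
  case 0
  then show ?case using has_integral_refl(2)[of _ \<tau>] by simp
next
  case (Suc n)
  have "(switching \<tau> \<delta> \<theta> u1 u2 has_integral 0) {\<tau> + n * \<delta>..\<tau> + (n + 1) * \<delta>}"
    using switching_within_period[of n "\<tau> + (n + 1) * \<delta>"] \<delta> by force
  from has_integral_combine[OF _ _ Suc this] \<delta> show ?case by (simp add: algebra_simps)
qed

text \<open>
  The nonnegative rate comes first in each period and the rates average to zero, so the primitive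
  returns to \<open>0\<close> after every period, never becomes negative, and rises by at most \<open>\<delta> * u1\<close>.
\<close>

lemma switching_integral_bounds:
  assumes "\<tau> \<le> t"
  shows "0 \<le> (LBINT s:{\<tau>..t}. switching \<tau> \<delta> \<theta> u1 u2 s)" "(LBINT s:{\<tau>..t}. switching \<tau> \<delta> \<theta> u1 u2 s) \<le> \<delta> * u1"
proof -
  define n where "n = nat \<lfloor>(t - \<tau>) / \<delta>\<rfloor>"
  have "real n = \<lfloor>(t - \<tau>) / \<delta>\<rfloor>" using assms \<delta> by (simp add: n_def)
  then have "real n \<le> (t - \<tau>) / \<delta>" "(t - \<tau>) / \<delta> \<le> real n + 1" by linarith+
  then have n: "\<tau> + n * \<delta> \<le> t" "t \<le> \<tau> + (n + 1) * \<delta>" using \<delta> by (auto simp: field_simps)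
  obtain I where I: "(switching \<tau> \<delta> \<theta> u1 u2 has_integral I) {\<tau> + n * \<delta>..t}" "0 \<le> I" "I \<le> \<delta> * u1"
    using switching_within_period[OF n] by blast
  have "(switching \<tau> \<delta> \<theta> u1 u2 has_integral 0 + I) {\<tau>..t}"
    by (rule has_integral_combine[OF _ n(1) switching_whole_periods I(1)]) (use \<delta> in simp)
  moreover have "set_integrable lborel {\<tau>..t} (switching \<tau> \<delta> \<theta> u1 u2)"
    by (rule set_integrable_bounded_Icc[OF measurable_switching abs_switching_le])
  ultimately have "(LBINT s:{\<tau>..t}. switching \<tau> \<delta> \<theta> u1 u2 s) = I"
    by (simp add: set_borel_integral_eq_integral integral_unique)
  then show "0 \<le> (LBINT s:{\<tau>..t}. switching \<tau> \<delta> \<theta> u1 u2 s)"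
    "(LBINT s:{\<tau>..t}. switching \<tau> \<delta> \<theta> u1 u2 s) \<le> \<delta> * u1" using I by auto
qed

end

section \<open>The Hamiltonian\<close>

locale production_problem =
  fixes A Q :: "real set" and R C :: "real \<Rightarrow> real" and \<beta> :: real
  assumes A: "closed A" "A \<subseteq> {0..}" "0 \<in> A" "A - {0} \<noteq> {}"
    and Q: "compact Q" "Q \<subseteq> {0..}" "0 \<in> Q" "Q - {0} \<noteq> {}"
    and R: "continuous_on Q R" "\<And>q. q \<in> Q \<Longrightarrow> 0 \<le> R q" "R 0 = 0"
    and C: "continuous_on A C" "\<And>a. a \<in> A \<Longrightarrow> 0 \<le> C a" "mono_on A C"
      "\<not> bounded A \<Longrightarrow> filterlim (\<lambda>a. C a / a) at_top (inf at_top (principal A))"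
    and \<beta>: "0 < \<beta>"
begin

abbreviation H :: "real \<Rightarrow> real" where "H \<equiv> hamiltonian A Q R C"
abbreviation \<zeta> :: real where "\<zeta> \<equiv> least_minimizer H"

text \<open>
  If \<open>A\<close> is unbounded, the superlinear cost makes every sufficiently large rate worse than producing
  nothing. In either case the supremum over \<open>A\<close> is attained on a compact part.
\<close>

lemma cost_coercive: "\<exists>B\<ge>0. \<forall>z\<le>Z. \<forall>a\<in>A. a > B \<longrightarrow> a * z - C a < 0 * z - C 0"
proof (cases "bounded A")
  case True
  then obtain B where B: "\<And>a. a \<in> A \<Longrightarrow> \<bar>a\<bar> \<le> B" by (auto simp: bounded_real)
  moreover have "0 \<le> B" using B[OF A(3)] by simp
  ultimately show ?thesis by (intro exI[of _ B]) force
next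
  case False
  have "eventually (\<lambda>a. C a / a \<ge> \<bar>Z\<bar> + 1) (inf at_top (principal A))"
    using C(4)[OF False] by (auto simp: filterlim_at_top)
  then obtain N where N: "\<And>a. a \<in> A \<Longrightarrow> a \<ge> N \<Longrightarrow> C a / a \<ge> \<bar>Z\<bar> + 1"
    by (auto simp: eventually_inf_principal eventually_at_top_linorder)
  define B where "B = max (max N 0) (C 0)"
  have "a * z - C a < 0 * z - C 0" if "z \<le> Z" "a \<in> A" "a > B" for z a
  proof -
    have a: "a \<ge> N" "a > 0" "a > C 0" using that by (auto simp: B_def)
    then have "(\<bar>Z\<bar> + 1) * a \<le> C a" using N[OF that(2)] by (simp add: pos_le_divide_eq)
    moreover have "z * a \<le> \<bar>Z\<bar> * a" using that(1) a by (intro mult_right_mono) auto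
    moreover have "(\<bar>Z\<bar> + 1) * a = \<bar>Z\<bar> * a + a" by (simp add: algebra_simps)
    ultimately show ?thesis using a unfolding mult_zero_left mult.commute[of a z] by linarith
  qed
  then show ?thesis by (intro exI[of _ B]) (auto simp: B_def)
qed

lemma best_production_exists: "\<exists>a\<in>A. \<forall>a'\<in>A. a' * z - C a' \<le> a * z - C a"
proof -
  obtain B where B: "0 \<le> B" "\<And>a. a \<in> A \<Longrightarrow> a > B \<Longrightarrow> a * z - C a < 0 * z - C 0"
    using cost_coercive[of z] by blast
  have cpt: "compact (A \<inter> {0..B})" using A(1) by (auto intro: closed_Int_compact)
  have "continuous_on (A \<inter> {0..B}) (\<lambda>a. a * z - C a)"
    by (intro continuous_intros continuous_on_subset[OF C(1)]) auto
  then obtain a where a: "a \<in> A \<inter> {0..B}" "\<And>a'. a' \<in> A \<inter> {0..B} \<Longrightarrow> a' * z - C a' \<le> a * z - C a"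
    using continuous_attains_sup[OF cpt] A(3) B(1) by fastforce
  have "a' * z - C a' \<le> a * z - C a" if "a' \<in> A" for a'
  proof (cases "a' \<le> B")
    case True
    then show ?thesis using a(2)[of a'] that A(2) by auto
  next
    case False
    then show ?thesis using B(2)[of a'] a(2)[of 0] that A(3) B(1) by force
  qed
  then show ?thesis using a by blast
qed

lemma best_sales_exists: "\<exists>q\<in>Q. \<forall>q'\<in>Q. R q' - q' * z \<le> R q - q * z"
proof -
  have "continuous_on Q (\<lambda>q. R q - q * z)"
    by (intro continuous_intros R(1))
  then show ?thesis using continuous_attains_sup[OF Q(1)] Q(3) by fastforce
qed

definition best_production :: "real \<Rightarrow> real" where
  "best_production z = (SOME a. a \<in> A \<and> (\<forall>a'\<in>A. a' * z - C a' \<le> a * z - C a))"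

definition best_sales :: "real \<Rightarrow> real" where
  "best_sales z = (SOME q. q \<in> Q \<and> (\<forall>q'\<in>Q. R q' - q' * z \<le> R q - q * z))"

definition net_production :: "real \<Rightarrow> real" where
  "net_production z = best_production z - best_sales z"

lemma best_production:
  "best_production z \<in> A" "a \<in> A \<Longrightarrow> a * z - C a \<le> best_production z * z - C (best_production z)"
  using someI_ex[of "\<lambda>a. a \<in> A \<and> (\<forall>a'\<in>A. a' * z - C a' \<le> a * z - C a)"] best_production_exists[of z]
  unfolding best_production_def by blast+

lemma best_sales:
  "best_sales z \<in> Q" "q \<in> Q \<Longrightarrow> R q - q * z \<le> R (best_sales z) - best_sales z * z"
  using someI_ex[of "\<lambda>q. q \<in> Q \<and> (\<forall>q'\<in>Q. R q' - q' * z \<le> R q - q * z)"] best_sales_exists[of z]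
  unfolding best_sales_def by blast+

lemma H_eq: "H z = R (best_sales z) - C (best_production z) + z * net_production z"
proof -
  have "(SUP q\<in>Q. R q - q * z) = R (best_sales z) - best_sales z * z"
    by (rule cSup_eq_maximum) (use best_sales in auto)
  moreover have "(SUP a\<in>A. a * z - C a) = best_production z * z - C (best_production z)"
    by (rule cSup_eq_maximum) (use best_production in auto)
  ultimately show ?thesis
    by (simp add: hamiltonian_def revenue_conjugate_def cost_conjugate_def net_production_def algebra_simps)
qed

lemma H_ge:
  assumes "a \<in> A" "q \<in> Q"
  shows "R q - C a + z * (a - q) \<le> H z"
  using best_production(2)[OF assms(1), of z] best_sales(2)[OF assms(2), of z]
  unfolding H_eq net_production_def by (simp add: algebra_simps)

lemma best_production_mono: "mono best_production"
proof (rule monoI)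
  fix y z :: real assume yz: "y \<le> z"
  have "(best_production z - best_production y) * (z - y) \<ge> 0"
    using best_production(2)[OF best_production(1)[of y], of z] best_production(2)[OF best_production(1)[of z], of y]
    by (simp add: algebra_simps)
  then show "best_production y \<le> best_production z" using yz by (cases "y = z") (auto simp: zero_le_mult_iff)
qed

lemma best_sales_antimono: "antimono best_sales"
proof (rule antimonoI)
  fix y z :: real assume yz: "y \<le> z"
  have "(best_sales y - best_sales z) * (z - y) \<ge> 0"
    using best_sales(2)[OF best_sales(1)[of y], of z] best_sales(2)[OF best_sales(1)[of z], of y]
    by (simp add: algebra_simps)
  then show "best_sales z \<le> best_sales y" using yz by (cases "y = z") (auto simp: zero_le_mult_iff)
qed

lemma subgradient_H: "subgradient_on UNIV H net_production"
  unfolding subgradient_on_def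
proof (intro ballI)
  fix z w :: real
  show "H z + net_production z * (w - z) \<le> H w"
    using H_ge[OF best_production(1)[of z] best_sales(1)[of z], of w]
    unfolding H_eq[of z] net_production_def by (simp add: algebra_simps)
qed

lemma mono_net_production: "mono net_production"
  using subgradient_on_mono[OF subgradient_H] by (simp add: mono_on_def mono_def)

lemma convex_H: "convex_on UNIV H"
proof (rule convex_onI)
  fix t x y :: real assume t: "0 < t" "t < 1"
  define z where "z = (1 - t) * x + t * y"
  have "(1 - t) * (H z + net_production z * (x - z)) + t * (H z + net_production z * (y - z)) \<le> (1 - t) * H x + t * H y"
    using t subgradient_onD[OF subgradient_H, of z] by (intro add_mono mult_left_mono) auto
  moreover have "(1 - t) * (H z + net_production z * (x - z)) + t * (H z + net_production z * (y - z)) = H z"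
    by (simp add: z_def algebra_simps)
  ultimately show "H ((1 - t) *\<^sub>R x + t *\<^sub>R y) \<le> (1 - t) * H x + t * H y"
    by (simp add: z_def)
qed simp

lemma isCont_H: "isCont H z"
  using convex_on_continuous[OF open_UNIV convex_H] by (simp add: continuous_on_eq_continuous_at)

text \<open>
  Some revenue-maximising sales rate at price \<open>0\<close> is positive, because \<open>R\<close> is nonnegative and vanishes
  at \<open>0\<close>; a negative price makes that rate strictly more profitable.
\<close>

lemma H_gt_if_neg:
  assumes "z < 0"
  shows "H 0 < H z"
proof -
  obtain q1 where q1: "q1 \<in> Q" "q1 > 0" using Q(2,4) by force
  obtain q where q: "q \<in> Q" "q > 0" "R (best_sales 0) \<le> R q"
  proof (cases "best_sales 0 = 0")
    case True
    then show ?thesis using that[of q1] q1 R(2,3) by auto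
  next
    case False
    then show ?thesis using that[of "best_sales 0"] best_sales(1)[of 0] Q(2) by force
  qed
  have "C 0 \<le> C (best_production 0)"
    using C(3) A(2,3) best_production(1)[of 0] by (auto simp: mono_on_def)
  then have "H 0 \<le> R q - C 0" using q unfolding H_eq by simp
  also have "\<dots> < R q - C 0 + z * (0 - q)" using assms q by (simp add: mult_less_0_iff)
  also have "\<dots> \<le> H z" by (rule H_ge[OF A(3) q(1)])
  finally show ?thesis .
qed

lemma least_minimizer:
  shows zeta_nonneg: "0 \<le> \<zeta>" and zeta_minimizes: "\<And>z. H \<zeta> \<le> H z" and zeta_least: "\<And>z. z < \<zeta> \<Longrightarrow> H \<zeta> < H z"
proof -
  obtain a where a: "a \<in> A" "a > 0" using A(2,4) by force
  define Z where "Z = max 0 ((H 0 + C a) / a)"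
  have big: "H 0 < H z" if "z > Z" for z
  proof -
    have "(H 0 + C a) / a < z" using that by (simp add: Z_def)
    then have "H 0 + C a < z * a" using a by (simp add: pos_divide_less_eq)
    then show ?thesis using H_ge[OF a(1) Q(3), of z] R(3) by simp
  qed
  have contH: "continuous_on S H" for S by (simp add: continuous_at_imp_continuous_on isCont_H)
  obtain z0 where z0: "z0 \<in> {0..Z}" "\<And>z. z \<in> {0..Z} \<Longrightarrow> H z0 \<le> H z"
    using continuous_attains_inf[of "{0..Z}" H] contH by (auto simp: Z_def)
  have min: "H z0 \<le> H z" for z
    using z0(2)[of z] z0(2)[of 0] H_gt_if_neg[of z] big[of z] by (cases "z < 0"; cases "z > Z") (auto simp: Z_def)
  have argmin: "argmin_set H = {z. H z = H z0}"
    using min by (auto simp: argmin_set_def is_arg_min_linorder order.antisym)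
  have sub: "{z. H z = H z0} \<subseteq> {0..Z}"
  proof
    fix z assume "z \<in> {z. H z = H z0}"
    then have "\<not> H 0 < H z" using min[of 0] by auto
    then show "z \<in> {0..Z}" using H_gt_if_neg[of z] big[of z] by force
  qed
  have "closed {z. H z = H z0}"
    by (intro closed_Collect_eq contH continuous_intros)
  then have "compact {z. H z = H z0}"
    using compact_Int_closed[of "{0..Z}" "{z. H z = H z0}"] sub by (simp add: Int_absorb1)
  then obtain s where s: "s \<in> {z. H z = H z0}" "\<And>z. z \<in> {z. H z = H z0} \<Longrightarrow> s \<le> z"
    using compact_attains_inf[of "{z. H z = H z0}"] by blast
  have "\<zeta> = s"
    unfolding least_minimizer_def argmin by (rule Least_equality) (use s in auto)
  then have zeta: "H \<zeta> = H z0" "\<And>z. H z = H z0 \<Longrightarrow> \<zeta> \<le> z" using s by auto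
  show "0 \<le> \<zeta>" using zeta(1) sub by auto
  show "H \<zeta> \<le> H z" for z using zeta(1) min by simp
  show "H \<zeta> < H z" if "z < \<zeta>" for z using zeta(1) zeta(2)[of z] min[of z] that by force
qed

lemma net_production_neg:
  assumes "z < \<zeta>"
  shows "net_production z < 0"
proof -
  have "net_production z * (\<zeta> - z) < 0"
    using subgradient_onD[OF subgradient_H, of z \<zeta>] zeta_least[OF assms] by simp
  then show ?thesis using assms by (simp add: mult_less_0_iff)
qed

lemma net_production_nonneg:
  assumes "\<zeta> < z"
  shows "0 \<le> net_production z"
proof -
  have "net_production z * (\<zeta> - z) \<le> 0"
    using subgradient_onD[OF subgradient_H, of z \<zeta>] zeta_minimizes[of z] by simp
  then show ?thesis using assms by (simp add: mult_le_0_iff)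
qed

definition optimal_rates :: "real \<Rightarrow> real \<Rightarrow> real \<Rightarrow> bool" where
  "optimal_rates z a q \<longleftrightarrow> a \<in> A \<and> q \<in> Q \<and> R q - C a = H z - z * (a - q)"

lemma optimal_best: "optimal_rates z (best_production z) (best_sales z)"
  using best_production(1) best_sales(1) H_eq[of z] by (simp add: optimal_rates_def net_production_def)

text \<open>
  At the minimiser itself the net production of the selected rates may have either sign. Rates that
  are optimal at prices slightly above \<open>\<zeta>\<close> have nonnegative net production, those slightly below have
  negative net production, and by compactness both signs survive in limits that are optimal at \<open>\<zeta>\<close>.
\<close>

lemma optimal_rates_of_sign:
  assumes sgn: "\<sigma> = 1 \<or> \<sigma> = (-1::real)"
  shows "\<exists>a q. optimal_rates \<zeta> a q \<and> 0 \<le> \<sigma> * (a - q)"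
proof -
  define z where "z n = \<zeta> + \<sigma> * inverse (real (Suc n))" for n :: nat
  define f where "f n = (best_production (z n), best_sales (z n))" for n
  have zlim: "z \<longlonglongrightarrow> \<zeta>"
    unfolding z_def using tendsto_add[OF tendsto_const tendsto_mult[OF tendsto_const LIMSEQ_inverse_real_of_nat], of \<zeta> \<sigma>] by simp
  have zle: "z n \<le> \<zeta> + 1" for n
  proof -
    have "\<sigma> * w \<le> 1" if "0 < w" "w \<le> 1" for w using sgn that by auto
    from this[of "inverse (real (Suc n))"] show ?thesis
      unfolding z_def by (intro add_left_mono) (simp add: inverse_eq_divide)
  qed
  have cpt: "compact ((A \<inter> {0..best_production (\<zeta> + 1)}) \<times> Q)"
    using A(1) Q(1) by (auto intro: closed_Int_compact compact_Times)
  have "f n \<in> (A \<inter> {0..best_production (\<zeta> + 1)}) \<times> Q" for n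
    using best_production(1)[of "z n"] best_sales(1)[of "z n"] A(2) monoD[OF best_production_mono zle[of n]]
    by (auto simp: f_def)
  then obtain l r where lr: "l \<in> (A \<inter> {0..best_production (\<zeta> + 1)}) \<times> Q" "strict_mono r" "(f \<circ> r) \<longlonglongrightarrow> l"
    using cpt unfolding compact_def by meson
  obtain a q where l: "l = (a, q)" by fastforce
  have aq: "a \<in> A" "q \<in> Q" using lr(1) l by auto
  have lima: "(\<lambda>n. best_production (z (r n))) \<longlonglongrightarrow> a" and limq: "(\<lambda>n. best_sales (z (r n))) \<longlonglongrightarrow> q"
    using tendsto_fst[OF lr(3)] tendsto_snd[OF lr(3)] by (auto simp: l f_def o_def)
  have limz: "(\<lambda>n. z (r n)) \<longlonglongrightarrow> \<zeta>"
    using LIMSEQ_subseq_LIMSEQ[OF zlim lr(2)] by (simp add: o_def)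
  have limC: "(\<lambda>n. C (best_production (z (r n)))) \<longlonglongrightarrow> C a"
    by (rule continuous_on_tendsto_compose[OF C(1) lima aq(1)]) (auto simp: best_production(1))
  have limR: "(\<lambda>n. R (best_sales (z (r n)))) \<longlonglongrightarrow> R q"
    by (rule continuous_on_tendsto_compose[OF R(1) limq aq(2)]) (auto simp: best_sales(1))
  have limH: "(\<lambda>n. H (z (r n))) \<longlonglongrightarrow> H \<zeta>"
    by (rule isCont_tendsto_compose[OF isCont_H limz])
  have "(\<lambda>n. R (best_sales (z (r n))) - C (best_production (z (r n)))
        + z (r n) * (best_production (z (r n)) - best_sales (z (r n)))) \<longlonglongrightarrow> R q - C a + \<zeta> * (a - q)"
    by (intro tendsto_intros lima limq limz limC limR)
  then have "(\<lambda>n. H (z (r n))) \<longlonglongrightarrow> R q - C a + \<zeta> * (a - q)"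
    by (simp add: H_eq net_production_def)
  then have "H \<zeta> = R q - C a + \<zeta> * (a - q)"
    using limH LIMSEQ_unique by blast
  moreover have "0 \<le> \<sigma> * (a - q)"
  proof (rule LIMSEQ_le_const)
    show "(\<lambda>n. \<sigma> * (best_production (z (r n)) - best_sales (z (r n)))) \<longlonglongrightarrow> \<sigma> * (a - q)"
      by (intro tendsto_intros lima limq)
    have "0 \<le> \<sigma> * net_production (z n)" for n
    proof (cases "\<sigma> = 1")
      case True
      then have "\<zeta> < z n" by (simp add: z_def)
      then show ?thesis using True net_production_nonneg by simp
    next
      case False
      then have *: "\<sigma> = -1" using sgn by simp
      then have "z n < \<zeta>" by (simp add: z_def)
      then show ?thesis using * net_production_neg[of "z n"] by simp
    qed
    then show "\<exists>N. \<forall>n\<ge>N. 0 \<le> \<sigma> * (best_production (z (r n)) - best_sales (z (r n)))"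
      by (simp add: net_production_def)
  qed
  ultimately show ?thesis
    using aq by (intro exI[of _ a] exI[of _ q]) (simp add: optimal_rates_def)
qed

section \<open>The function \<open>\<Psi>\<close> and its inverse\<close>

text \<open>
  A selection of subgradients of \<open>H\<close> on \<open>(- \<infinity>, \<zeta>]\<close>. At \<open>\<zeta>\<close> the selected net production may be positive;
  taking the subgradient \<open>0\<close> there keeps the selection nonpositive up to the endpoint.
\<close>

definition marginal :: "real \<Rightarrow> real" where
  "marginal z = (if z < \<zeta> then net_production z else 0)"

definition Psi_slope :: "real \<Rightarrow> real" where
  "Psi_slope z = marginal z / (\<beta> * z)"

lemma marginal_neg: "z < \<zeta> \<Longrightarrow> marginal z < 0"
  by (simp add: marginal_def net_production_neg)

lemma marginal_nonpos: "marginal z \<le> 0"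
  by (simp add: marginal_def net_production_neg less_imp_le)

lemma subgradient_H_marginal: "subgradient_on {..\<zeta>} H marginal"
  unfolding subgradient_on_def
proof (intro ballI)
  fix x y assume "x \<in> {..\<zeta>}" "y \<in> {..\<zeta>}"
  then show "H x + marginal x * (y - x) \<le> H y"
    using subgradient_onD[OF subgradient_H, of x y] zeta_minimizes[of y] by (auto simp: marginal_def)
qed

lemma Psi_slope_neg: "0 < z \<Longrightarrow> z < \<zeta> \<Longrightarrow> Psi_slope z < 0"
  using marginal_neg[of z] \<beta> by (simp add: Psi_slope_def divide_neg_pos)

lemma Psi_slope_nonpos: "0 < z \<Longrightarrow> Psi_slope z \<le> 0"
  using marginal_nonpos[of z] \<beta> by (simp add: Psi_slope_def divide_nonpos_pos)

lemma Psi_slope_mono: "mono_on {0<..\<zeta>} Psi_slope"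
proof (rule mono_onI)
  fix x y assume xy: "x \<in> {0<..\<zeta>}" "y \<in> {0<..\<zeta>}" "x \<le> y"
  have "marginal x \<le> marginal y"
    using mono_onD[OF subgradient_on_mono[OF subgradient_H_marginal]] xy by auto
  then have "- marginal y / (\<beta> * y) \<le> - marginal x / (\<beta> * x)"
    using xy marginal_nonpos[of x] marginal_nonpos[of y] \<beta> by (intro frac_le) auto
  then show "Psi_slope x \<le> Psi_slope y" by (simp add: Psi_slope_def)
qed

lemma H_has_derivative:
  assumes "isCont net_production z"
  shows "(H has_real_derivative net_production z) (at z)"
  using subgradient_on_has_derivative[OF subgradient_H, of z] assms by simp

lemma countable_kinks: "countable {z. \<not> isCont net_production z}"
  by (rule mono_ctble_discont[OF mono_net_production])

lemma Psi_eq: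
  "Psi H \<beta> s = - (LBINT z:{s..\<zeta>}. Psi_slope z)"
proof -
  have "(LBINT z:{s..\<zeta>}. deriv H z / (\<beta> * z)) = (LBINT z:{s..\<zeta>}. Psi_slope z)"
    unfolding set_lebesgue_integral_def
  proof (rule integral_discrete_difference)
    show "countable ({z. \<not> isCont net_production z} \<union> {\<zeta>})" using countable_kinks by simp
    fix z assume z: "z \<notin> {z. \<not> isCont net_production z} \<union> {\<zeta>}"
    then have "deriv H z = net_production z" by (auto intro: DERIV_imp_deriv H_has_derivative)
    then show "indicat_real {s..\<zeta>} z *\<^sub>R (deriv H z / (\<beta> * z)) = indicat_real {s..\<zeta>} z *\<^sub>R Psi_slope z"
      using z by (auto simp: Psi_slope_def marginal_def indicator_def)
  qed auto
  then show ?thesis by (simp add: Psi_def)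
qed

lemma subgradient_Psi: "subgradient_on {0<..\<zeta>} (Psi H \<beta>) Psi_slope"
  unfolding subgradient_on_def
proof (intro ballI)
  fix x y assume xy: "x \<in> {0<..\<zeta>}" "y \<in> {0<..\<zeta>}"
  have "mono_on {min x y..\<zeta>} Psi_slope"
    by (rule mono_on_subset[OF Psi_slope_mono]) (use xy in auto)
  from subgradient_onD[OF subgradient_on_integral[OF this], of x y]
  show "Psi H \<beta> x + Psi_slope x * (y - x) \<le> Psi H \<beta> y"
    using xy by (simp add: Psi_eq)
qed

lemma Psi_zeta: "Psi H \<beta> \<zeta> = 0"
  by (simp add: Psi_eq LBINT_point)

lemma Psi_less:
  assumes "0 < x" "x < y" "y \<le> \<zeta>"
  shows "Psi H \<beta> y < Psi H \<beta> x"
proof -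
  \<comment> \<open>For \<open>y = \<zeta>\<close> the slope vanishes at \<open>y\<close>, so strictness has to come from an interior point.\<close>
  define m where "m = (x + y) / 2"
  have m: "x < m" "m < y" using assms by (auto simp: m_def)
  have "Psi H \<beta> y - Psi H \<beta> m \<le> Psi_slope y * (y - m)"
    by (rule subgradient_increment_bounds(2)[OF subgradient_Psi]) (use assms m in auto)
  also have "\<dots> \<le> 0" using Psi_slope_nonpos[of y] assms m by (intro mult_nonpos_nonneg) auto
  finally have "Psi H \<beta> y \<le> Psi H \<beta> m" by simp
  moreover have "Psi H \<beta> m - Psi H \<beta> x \<le> Psi_slope m * (m - x)"
    by (rule subgradient_increment_bounds(2)[OF subgradient_Psi]) (use assms m in auto)
  moreover have "Psi_slope m * (m - x) < 0"
    using Psi_slope_neg[of m] assms m by (intro mult_neg_pos) auto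
  ultimately show ?thesis by simp
qed

lemma Psi_less_iff:
  assumes "x \<in> {0<..\<zeta>}" "y \<in> {0<..\<zeta>}"
  shows "Psi H \<beta> y < Psi H \<beta> x \<longleftrightarrow> x < y"
  using Psi_less[of x y] Psi_less[of y x] assms by (cases x y rule: linorder_cases) auto

lemma Psi_nonneg: "s \<in> {0<..\<zeta>} \<Longrightarrow> 0 \<le> Psi H \<beta> s"
  using Psi_less[of s \<zeta>] Psi_zeta by (cases "s = \<zeta>") auto

lemma continuous_on_Psi:
  assumes "0 < s"
  shows "continuous_on {s..\<zeta>} (Psi H \<beta>)"
proof (rule continuous_onI)
  fix x e :: real assume x: "x \<in> {s..\<zeta>}" and e: "0 < e"
  define K where "K = - Psi_slope s"
  have K: "0 \<le> K" using Psi_slope_nonpos[OF assms] by (simp add: K_def)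
  have lip: "\<bar>Psi H \<beta> b - Psi H \<beta> a\<bar> \<le> K * \<bar>b - a\<bar>" if "a \<in> {s..\<zeta>}" "b \<in> {s..\<zeta>}" "a \<le> b" for a b
  proof -
    have "Psi H \<beta> b \<le> Psi H \<beta> a" using Psi_less[of a b] that assms by (cases "a = b") auto
    moreover have "Psi_slope a * (b - a) \<le> Psi H \<beta> b - Psi H \<beta> a"
      by (rule subgradient_increment_bounds(1)[OF subgradient_Psi]) (use that assms in auto)
    moreover have "Psi_slope s * (b - a) \<le> Psi_slope a * (b - a)"
      using that assms by (intro mult_right_mono mono_onD[OF Psi_slope_mono]) auto
    ultimately show ?thesis using that by (simp add: K_def)
  qed
  have "dist (Psi H \<beta> y) (Psi H \<beta> x) \<le> e" if y: "y \<in> {s..\<zeta>}" "dist y x < e / (K + 1)" for y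
  proof -
    have "\<bar>Psi H \<beta> y - Psi H \<beta> x\<bar> \<le> K * \<bar>y - x\<bar>"
      using lip[of x y] lip[of y x] x y by (cases "x \<le> y") (auto simp: abs_minus_commute)
    also have "\<dots> \<le> (K + 1) * \<bar>y - x\<bar>" by (simp add: mult_right_mono)
    also have "\<dots> \<le> e" using y(2) K by (simp add: dist_real_def field_simps)
    finally show ?thesis by (simp add: dist_real_def)
  qed
  then show "\<exists>d>0. \<forall>y\<in>{s..\<zeta>}. dist y x < d \<longrightarrow> dist (Psi H \<beta> y) (Psi H \<beta> x) \<le> e"
    using e K by (intro exI[of _ "e / (K + 1)"]) auto
qed

text \<open>Halving the price raises \<open>\<Psi>\<close> by at least a fixed amount, since \<open>- H'\<close> is bounded away from \<open>0\<close>
  on \<open>(0, \<zeta> / 2]\<close>.\<close>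

lemma Psi_unbounded:
  assumes "0 < \<zeta>"
  shows "\<exists>s\<in>{0<..\<zeta>}. K \<le> Psi H \<beta> s"
proof -
  define c where "c = - marginal (\<zeta> / 2) / (2 * \<beta>)"
  have c: "c > 0" using marginal_neg[of "\<zeta> / 2"] assms \<beta> by (simp add: c_def divide_neg_pos)
  have step: "Psi H \<beta> s + c \<le> Psi H \<beta> (s / 2)" if s: "0 < s" "s \<le> \<zeta> / 2" for s
  proof -
    have "c \<le> - marginal s / (2 * \<beta>)" unfolding c_def
      using mono_onD[OF subgradient_on_mono[OF subgradient_H_marginal], of s "\<zeta> / 2"] s assms \<beta>
      by (intro divide_right_mono) auto
    also have "\<dots> = Psi_slope s * (s / 2 - s)" using s \<beta> by (simp add: Psi_slope_def field_simps)
    also have "\<dots> \<le> Psi H \<beta> (s / 2) - Psi H \<beta> s"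
      by (rule subgradient_increment_bounds(1)[OF subgradient_Psi]) (use s assms in auto)
    finally show ?thesis by simp
  qed
  have grow: "real n * c \<le> Psi H \<beta> (\<zeta> / 2 ^ Suc n)" for n
  proof (induction n)
    case 0
    then show ?case using Psi_nonneg[of "\<zeta> / 2"] assms by simp
  next
    case (Suc n)
    have "\<zeta> / 2 ^ Suc n \<le> \<zeta> / 2" using assms by (simp add: divide_simps)
    with step[of "\<zeta> / 2 ^ Suc n"] Suc assms show ?case by (simp add: algebra_simps)
  qed
  obtain n where n: "K / c \<le> real n" using real_arch_simple by blast
  have "K \<le> real n * c" using n c by (simp add: divide_le_eq)
  moreover have "\<zeta> / 2 ^ Suc n \<in> {0<..\<zeta>}"
    using assms one_le_power[of "2::real" "Suc n"] by (simp add: divide_le_eq del: power_Suc)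
  ultimately show ?thesis using grow[of n] by force
qed

lemma Psi_ex1:
  assumes "0 < \<zeta>" "0 \<le> x"
  shows "\<exists>!s. s \<in> {0<..\<zeta>} \<and> x = Psi H \<beta> s"
proof -
  obtain s where s: "s \<in> {0<..\<zeta>}" "x \<le> Psi H \<beta> s" using Psi_unbounded[OF assms(1)] by blast
  then obtain r where "s \<le> r" "r \<le> \<zeta>" "Psi H \<beta> r = x"
    using IVT2'[of "Psi H \<beta>" \<zeta> x s] continuous_on_Psi[of s] Psi_zeta assms by auto
  then have r: "r \<in> {0<..\<zeta>}" "Psi H \<beta> r = x" using s by auto
  show ?thesis
  proof (rule ex1I[of _ r])
    fix s' assume s': "s' \<in> {0<..\<zeta>} \<and> x = Psi H \<beta> s'"
    then show "s' = r"
      using Psi_less_iff[of s' r] Psi_less_iff[of r s'] r by (cases s' r rule: linorder_cases) auto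
  qed (use r in auto)
qed

context
  assumes pos: "0 < \<zeta>"
begin

abbreviation \<xi> :: "real \<Rightarrow> real" where "\<xi> \<equiv> xi H \<beta>"

lemma xi:
  assumes "0 \<le> x"
  shows xi_range: "\<xi> x \<in> {0<..\<zeta>}" and Psi_xi: "Psi H \<beta> (\<xi> x) = x"
  using theI'[OF Psi_ex1[OF pos assms]] unfolding xi_def by auto

lemma xi_Psi:
  assumes "s \<in> {0<..\<zeta>}"
  shows "\<xi> (Psi H \<beta> s) = s"
  unfolding xi_def
  by (rule the1_equality[OF Psi_ex1[OF pos Psi_nonneg[OF assms]]]) (use assms in simp)

lemma xi_0: "\<xi> 0 = \<zeta>"
  using xi_Psi[of \<zeta>] Psi_zeta pos by simp

lemma xi_less_iff: "0 \<le> x \<Longrightarrow> 0 \<le> y \<Longrightarrow> \<xi> y < \<xi> x \<longleftrightarrow> x < y"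
  using Psi_less_iff[of "\<xi> y" "\<xi> x"] xi by simp

lemma xi_less_Psi: "0 \<le> x \<Longrightarrow> s \<in> {0<..\<zeta>} \<Longrightarrow> \<xi> x < s \<longleftrightarrow> Psi H \<beta> s < x"
  using Psi_less_iff[of "\<xi> x" s] xi by simp

lemma Psi_less_xi: "0 \<le> x \<Longrightarrow> s \<in> {0<..\<zeta>} \<Longrightarrow> s < \<xi> x \<longleftrightarrow> x < Psi H \<beta> s"
  using Psi_less_iff[of s "\<xi> x"] xi by simp

lemma antimono_xi: "antimono_on {0..} \<xi>"
proof (rule monotone_onI)
  fix x y :: real assume "x \<in> {0..}" "y \<in> {0..}" "x \<le> y"
  then show "\<xi> y \<le> \<xi> x" using xi_less_iff[of y x] by auto
qed

lemma xi_continuous: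
  assumes "0 \<le> x"
  shows "continuous (at x within {0..}) \<xi>"
  unfolding continuous_within
proof (rule order_tendstoI)
  fix l assume l: "l < \<xi> x"
  show "\<forall>\<^sub>F y in at x within {0..}. l < \<xi> y"
  proof (cases "0 < l")
    case True
    then have s: "l \<in> {0<..\<zeta>}" using l xi_range[OF assms] by simp
    then have "x < Psi H \<beta> l" using Psi_less_xi[OF assms s] l by simp
    then have "\<forall>\<^sub>F y in at x within {0..}. y < Psi H \<beta> l"
      by (rule order_tendstoD(2)[OF tendsto_ident_at])
    then show ?thesis
      by (rule eventually_rev_mp) (auto simp: eventually_at_filter Psi_less_xi[OF _ s])
  next
    case False
    have "l < \<xi> y" if "y \<in> {0..}" for y using xi_range[of y] that False by simp
    then show ?thesis by (simp add: eventually_at_filter)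
  qed
next
  fix u assume u: "\<xi> x < u"
  show "\<forall>\<^sub>F y in at x within {0..}. \<xi> y < u"
  proof (cases "u \<le> \<zeta>")
    case True
    then have s: "u \<in> {0<..\<zeta>}" using u xi_range[OF assms] by simp
    then have "Psi H \<beta> u < x" using xi_less_Psi[OF assms s] u by simp
    then have "\<forall>\<^sub>F y in at x within {0..}. Psi H \<beta> u < y"
      by (rule order_tendstoD(1)[OF tendsto_ident_at])
    then show ?thesis
      by (rule eventually_rev_mp) (auto simp: eventually_at_filter xi_less_Psi[OF _ s])
  next
    case False
    have "\<xi> y < u" if "y \<in> {0..}" for y using xi_range[of y] that False by simp
    then show ?thesis by (simp add: eventually_at_filter)
  qed
qed

lemma xi_tendsto_0: "(\<xi> \<longlongrightarrow> 0) at_top"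
proof (rule order_tendstoI)
  fix l :: real assume "l < 0"
  then have "l < \<xi> y" if "y \<ge> 0" for y using xi_range[OF that] by simp
  then show "\<forall>\<^sub>F y in at_top. l < \<xi> y" by (auto intro: eventually_at_top_linorderI)
next
  fix u :: real assume u: "0 < u"
  define s where "s = min u \<zeta>"
  have s: "s \<in> {0<..\<zeta>}" using u pos by (simp add: s_def)
  have "\<xi> y < u" if "y \<ge> Psi H \<beta> s + 1" for y
    using xi_less_Psi[OF _ s, of y] Psi_nonneg[OF s] that by (simp add: s_def)
  then show "\<forall>\<^sub>F y in at_top. \<xi> y < u" by (rule eventually_at_top_linorderI)
qed

text \<open>
  The slope of \<open>\<Psi>\<close> may tend to \<open>0\<close> only at \<open>\<zeta> = \<xi> 0\<close>, so \<open>\<xi>\<close> is Lipschitz away from \<open>0\<close>.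
\<close>

lemma xi_lipschitz:
  assumes "0 < \<eta>"
  shows "\<exists>L\<ge>0. \<forall>x\<ge>\<eta>. \<forall>y\<ge>x. \<xi> x - \<xi> y \<le> L * (y - x)"
proof -
  define c where "c = - Psi_slope (\<xi> \<eta>)"
  have "\<xi> \<eta> < \<zeta>" using xi_less_iff[of 0 \<eta>] assms xi_0 by simp
  then have c: "c > 0" using Psi_slope_neg[of "\<xi> \<eta>"] xi_range[of \<eta>] assms by (simp add: c_def)
  have "\<xi> x - \<xi> y \<le> (1 / c) * (y - x)" if xy: "\<eta> \<le> x" "x \<le> y" for x y
  proof -
    have x0: "0 \<le> x" "0 \<le> y" using assms xy by auto
    have le: "\<xi> y \<le> \<xi> x" "\<xi> x \<le> \<xi> \<eta>" using monotone_onD[OF antimono_xi] xy x0 assms by auto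
    have "c * (\<xi> x - \<xi> y) \<le> - Psi_slope (\<xi> x) * (\<xi> x - \<xi> y)"
      unfolding c_def using le xi_range x0 assms
      by (intro mult_right_mono le_imp_neg_le mono_onD[OF Psi_slope_mono]) auto
    also have "\<dots> \<le> y - x"
      using subgradient_increment_bounds(1)[OF subgradient_Psi xi_range[OF x0(1)] xi_range[OF x0(2)]] Psi_xi x0
      by (simp add: algebra_simps)
    finally show ?thesis using c by (simp add: field_simps)
  qed
  then show ?thesis using c by (intro exI[of _ "1 / c"]) auto
qed

lemma xi_has_derivative:
  assumes x: "0 < x" and cont: "isCont net_production (\<xi> x)"
  shows "\<exists>d<0. (\<xi> has_real_derivative d) (at x)"
proof -
  let ?s = "\<xi> x"
  have s: "0 < ?s" "?s < \<zeta>" using xi_range[of x] xi_less_iff[of 0 x] xi_0 x by auto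
  have "\<forall>\<^sub>F z in at ?s. marginal z = net_production z"
    using eventually_at_in_open'[of "{..<\<zeta>}" ?s] s
    by (auto elim!: eventually_mono simp: marginal_def)
  then have "isCont marginal ?s"
    using cont s unfolding isCont_def
    by (subst tendsto_cong) (auto simp: marginal_def)
  then have "isCont Psi_slope ?s"
    unfolding Psi_slope_def using s \<beta> by (intro continuous_intros) auto
  moreover have at: "at ?s within {0<..\<zeta>} = at ?s"
    using s by (intro at_within_interior interiorI[of "{0<..<\<zeta>}"]) auto
  ultimately have der: "(Psi H \<beta> has_real_derivative Psi_slope ?s) (at ?s)"
    using subgradient_on_has_derivative[OF subgradient_Psi, of ?s] s by simp
  have "(\<xi> has_real_derivative inverse (Psi_slope ?s)) (at x)"
  proof (rule DERIV_inverse_function[where f = "Psi H \<beta>" and a = 0 and b = "x + 1"])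
    show "(Psi H \<beta> has_real_derivative Psi_slope ?s) (at ?s)" by (rule der)
    show "Psi_slope ?s \<noteq> 0" using Psi_slope_neg[OF s] by simp
    have "at x within {0..} = at x"
      using x by (intro at_within_interior interiorI[of "{0<..}"]) auto
    then show "isCont \<xi> x"
      using xi_continuous[of x] x by simp
  qed (use x Psi_xi in auto)
  then show ?thesis using Psi_slope_neg[OF s] by (intro exI[of _ "inverse (Psi_slope ?s)"]) simp
qed

text \<open>
  The exceptional points are the stocks \<open>\<Psi> z\<close> at which the price \<open>z\<close> is a kink of \<open>H\<close>, and \<open>H\<close> has only
  countably many kinks.
\<close>

lemma xi_AE_derivative: "AE x in lborel. 0 < x \<longrightarrow> (\<exists>d<0. (\<xi> has_real_derivative d) (at x))"
proof -
  let ?K = "{z. \<not> isCont net_production z}"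
  have "countable (Psi H \<beta> ` ?K)" using countable_kinks by simp
  then have "AE x in lborel. x \<notin> Psi H \<beta> ` ?K"
    by (rule AE_discrete_difference[where M = lborel]) simp_all
  then show ?thesis
  proof eventually_elim
    case (elim x)
    have "isCont net_production (\<xi> x)" if "0 < x"
      using elim Psi_xi[of x] that by force
    then show ?case using xi_has_derivative by blast
  qed
qed

end

section \<open>Discounted prices bound the value from above\<close>

definition profit_rate :: "(real \<Rightarrow> real) \<Rightarrow> (real \<Rightarrow> real) \<Rightarrow> real \<Rightarrow> real" where
  "profit_rate \<alpha> q t = exp (- \<beta> * t) * (R (q t) - C (\<alpha> t))"

lemma payoff_eq: "payoff R C \<beta> \<alpha> q = extended_integral {0..} (profit_rate \<alpha> q)"
  by (simp add: payoff_def profit_rate_def[abs_def])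

text \<open>Here \<open>lam\<close> is the discounted price, so \<open>exp (\<beta> * t) * lam t\<close> is the current price of the stock.\<close>

definition price_profit_rate :: "(real \<Rightarrow> real) \<Rightarrow> real \<Rightarrow> real" where
  "price_profit_rate lam t = exp (- \<beta> * t) * H (exp (\<beta> * t) * lam t)"

lemma profit_rate_le:
  assumes "\<alpha> t \<in> A" "q t \<in> Q"
  shows "profit_rate \<alpha> q t \<le> price_profit_rate lam t - lam t * (\<alpha> t - q t)"
proof -
  have "R (q t) - C (\<alpha> t) \<le> H (exp (\<beta> * t) * lam t) - exp (\<beta> * t) * lam t * (\<alpha> t - q t)"
    using H_ge[OF assms, of "exp (\<beta> * t) * lam t"] by simp
  then have "profit_rate \<alpha> q t \<le> exp (- \<beta> * t) * (H (exp (\<beta> * t) * lam t) - exp (\<beta> * t) * lam t * (\<alpha> t - q t))"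
    unfolding profit_rate_def by (intro mult_left_mono) auto
  also have "\<dots> = price_profit_rate lam t - (exp (- \<beta> * t) * exp (\<beta> * t)) * lam t * (\<alpha> t - q t)"
    by (simp add: price_profit_rate_def algebra_simps)
  also have "exp (- \<beta> * t) * exp (\<beta> * t) = 1" by (simp flip: exp_add)
  finally show ?thesis by simp
qed

lemma profit_rate_eq:
  assumes "optimal_rates (exp (\<beta> * t) * lam t) (\<alpha> t) (q t)"
  shows "profit_rate \<alpha> q t = price_profit_rate lam t - lam t * (\<alpha> t - q t)"
proof -
  have "profit_rate \<alpha> q t = exp (- \<beta> * t) * (H (exp (\<beta> * t) * lam t) - exp (\<beta> * t) * lam t * (\<alpha> t - q t))"
    using assms by (simp add: profit_rate_def optimal_rates_def)
  also have "\<dots> = price_profit_rate lam t - (exp (- \<beta> * t) * exp (\<beta> * t)) * lam t * (\<alpha> t - q t)"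
    by (simp add: price_profit_rate_def algebra_simps)
  also have "exp (- \<beta> * t) * exp (\<beta> * t) = 1" by (simp flip: exp_add)
  finally show ?thesis by simp
qed

lemma profit_rate_measurable:
  assumes \<alpha>: "\<alpha> \<in> borel_measurable (restrict_space borel {0..})" "\<And>t. 0 \<le> t \<Longrightarrow> \<alpha> t \<in> A"
    and q: "q \<in> borel_measurable (restrict_space borel {0..})" "\<And>t. 0 \<le> t \<Longrightarrow> q t \<in> Q"
  shows "set_borel_measurable lborel {0..} (profit_rate \<alpha> q)"
proof -
  let ?M = "restrict_space borel {0::real..}"
  have "\<alpha> \<in> ?M \<rightarrow>\<^sub>M restrict_space borel A" "q \<in> ?M \<rightarrow>\<^sub>M restrict_space borel Q"
    using \<alpha> q by (auto intro!: measurable_restrict_space2 simp: space_restrict_space)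
  then have "(\<lambda>t. C (\<alpha> t)) \<in> borel_measurable ?M" "(\<lambda>t. R (q t)) \<in> borel_measurable ?M"
    using measurable_compose[OF _ borel_measurable_continuous_on_restrict[OF C(1)]]
      measurable_compose[OF _ borel_measurable_continuous_on_restrict[OF R(1)]] by auto
  moreover have "(\<lambda>t. exp (- \<beta> * t)) \<in> borel_measurable ?M"
    by (intro measurable_restrict_space1) simp
  ultimately have "profit_rate \<alpha> q \<in> borel_measurable ?M"
    unfolding profit_rate_def by simp
  then show ?thesis
    by (simp add: set_borel_measurable_def borel_measurable_restrict_space_iff)
qed

lemma bounded_sales: "\<exists>B. \<forall>q\<in>Q. \<bar>q\<bar> \<le> B"
  using compact_imp_bounded[OF Q(1)] by (auto simp: bounded_real)

lemma set_integrable_sales: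
  fixes q :: "real \<Rightarrow> real"
  assumes "q \<in> borel_measurable (restrict_space borel {0..})" "\<And>t. 0 \<le> t \<Longrightarrow> q t \<in> Q"
  shows "set_integrable lborel {0..t} q"
proof -
  obtain B where B: "\<And>q. q \<in> Q \<Longrightarrow> \<bar>q\<bar> \<le> B" using bounded_sales by blast
  have "(\<lambda>s. indicat_real {0..} s *\<^sub>R q s) \<in> borel_measurable lborel"
    using assms(1) by (subst (asm) borel_measurable_restrict_space_iff) (auto intro: borel_closed)
  then have "(\<lambda>s. indicator {0..t} s * (indicat_real {0..} s *\<^sub>R q s)) \<in> borel_measurable lborel" by simp
  also have "(\<lambda>s. indicator {0..t} s * (indicat_real {0..} s *\<^sub>R q s)) = (\<lambda>s. indicator {0..t} s * q s)"
    by (auto simp: indicator_def)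
  finally have meas: "set_borel_measurable lborel {0..t} q" by (simp add: set_borel_measurable_def)
  show ?thesis
  proof (rule set_integrable_bound[of lborel "{0..t}" "\<lambda>_. B"])
    show "set_integrable lborel {0..t} (\<lambda>_. B)"
      by (auto simp: set_integrable_def emeasure_lborel_Icc_eq intro!: integrable_real_indicator)
    have "norm (q s) \<le> norm B" if "s \<in> {0..t}" for s
      using B[OF assms(2), of s] that by auto
    then show "AE s in lborel. s \<in> {0..t} \<longrightarrow> norm (q s) \<le> norm B" by (intro always_eventually) auto
  qed (rule meas)
qed

text \<open>
  Weak duality: by \<open>profit_rate_le\<close> the payoff is at most the integral of \<open>price_profit_rate lam\<close> minus
  that of \<open>lam * (\<alpha> - q)\<close>. The stock never falls below \<open>0\<close>, which means that the primitive of \<open>\<alpha> - q\<close> is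
  at least \<open>- x\<close>, and so the second integral is at least \<open>- lam 0 * x\<close>.
\<close>

lemma payoff_le:
  assumes adm: "(\<alpha>, q) \<in> admissible A Q x"
    and anti: "antimono_on {0..} lam" and nn: "\<And>t. 0 \<le> t \<Longrightarrow> 0 \<le> lam t"
    and int: "set_integrable lborel {0..} (price_profit_rate lam)"
  shows "payoff R C \<beta> \<alpha> q \<le> ereal ((LBINT t:{0..}. price_profit_rate lam t) + lam 0 * x)"
proof -
  let ?f = "profit_rate \<alpha> q" and ?g = "price_profit_rate lam" and ?u = "\<lambda>t. \<alpha> t - q t"
  have \<alpha>: "\<alpha> \<in> borel_measurable (restrict_space borel {0..})" "\<And>t. 0 \<le> t \<Longrightarrow> \<alpha> t \<in> A"
    and q: "q \<in> borel_measurable (restrict_space borel {0..})" "\<And>t. 0 \<le> t \<Longrightarrow> q t \<in> Q"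
    and \<alpha>int: "\<And>t. 0 \<le> t \<Longrightarrow> set_integrable lborel {0..t} \<alpha>"
    and path: "\<And>t. 0 \<le> t \<Longrightarrow> 0 \<le> state_path x \<alpha> q t"
    using adm by (simp_all add: admissible_def)
  have state: "- x \<le> (LBINT s:{0..t}. ?u s)" if "0 \<le> t" for t
    using path[OF that] unfolding state_path_def by linarith
  have meas: "set_borel_measurable lborel {0..} ?f"
    using profit_rate_measurable[OF \<alpha> q] .
  obtain B where B: "\<And>q. q \<in> Q \<Longrightarrow> R q \<le> B"
    using compact_imp_bounded[OF compact_continuous_image[OF R(1) Q(1)]]
    by (auto simp: bounded_real) (meson abs_le_D1)
  have "extended_integral {0..} ?f \<le> ereal ((LBINT t:{0..}. ?g t) + lam 0 * x)"
  proof (rule extended_integral_le[OF meas])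
    show "set_integrable lborel {0..} (\<lambda>t. B * exp (- \<beta> * t))"
      using set_integrable_exp_minus(1)[OF \<beta>] by simp
    show "?f t \<le> B * exp (- \<beta> * t)" if "t \<in> {0..}" for t
      using B[OF q(2), of t] C(2)[OF \<alpha>(2), of t] that by (simp add: profit_rate_def mult.commute)
    assume fint: "set_integrable lborel {0..} ?f"
    have le: "(LBINT t:{0..T}. ?f t) \<le> (LBINT t:{0..T}. ?g t) + lam 0 * x" if T: "0 \<le> T" for T
    proof -
      have fT: "set_integrable lborel {0..T} ?f" and gT: "set_integrable lborel {0..T} ?g"
        using fint int by (auto intro: set_integrable_subset)
      have uT: "set_integrable lborel {0..T} ?u"
        using \<alpha>int[OF T] set_integrable_sales[OF q] by (rule set_integral_diff(1))
      have antiT: "antimono_on {0..T} lam" using anti by (rule monotone_on_subset) auto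
      note lT = set_integrable_antimono_weight[OF uT antiT]
      have "(LBINT t:{0..T}. ?f t) \<le> (LBINT t:{0..T}. ?g t - lam t * ?u t)"
        using \<alpha>(2) q(2) by (intro set_integral_mono fT set_integral_diff(1)[OF gT lT] profit_rate_le) auto
      also have "\<dots> = (LBINT t:{0..T}. ?g t) - (LBINT t:{0..T}. lam t * ?u t)"
        by (rule set_integral_diff(2)[OF gT lT])
      also have "lam 0 * (- x) \<le> (LBINT t:{0..T}. lam t * ?u t)"
        using T nn by (intro antimono_weight_integral_bounds(1)[OF uT antiT]) (auto intro: state)
      then have "(LBINT t:{0..T}. ?g t) - (LBINT t:{0..T}. lam t * ?u t) \<le> (LBINT t:{0..T}. ?g t) + lam 0 * x"
        by simp
      finally show ?thesis .
    qed
    show "(LBINT t:{0..}. ?f t) \<le> (LBINT t:{0..}. ?g t) + lam 0 * x"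
    proof (rule tendsto_le)
      show "((\<lambda>T. LBINT t:{0..T}. ?f t) \<longlongrightarrow> (LBINT t:{0..}. ?f t)) at_top"
        by (rule tendsto_LBINT_atLeast[OF fint])
      show "((\<lambda>T. (LBINT t:{0..T}. ?g t) + lam 0 * x) \<longlongrightarrow> (LBINT t:{0..}. ?g t) + lam 0 * x) at_top"
        by (intro tendsto_add tendsto_const tendsto_LBINT_atLeast[OF int])
      show "\<forall>\<^sub>F T in at_top. (LBINT t:{0..T}. ?f t) \<le> (LBINT t:{0..T}. ?g t) + lam 0 * x"
        using le by (rule eventually_at_top_linorderI)
    qed simp
  qed
  then show ?thesis by (simp add: payoff_eq)
qed

text \<open>
  The candidate price grows at rate \<open>\<beta>\<close> from \<open>p\<close> until it reaches \<open>\<zeta>\<close> and stays there; discounting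
  turns it into the constant \<open>p\<close> followed by \<open>\<zeta> * exp (- \<beta> * t)\<close>.
\<close>

definition price_path :: "real \<Rightarrow> real \<Rightarrow> real" where
  "price_path p t = min p (\<zeta> * exp (- \<beta> * t))"

definition dual_value :: "real \<Rightarrow> real" where
  "dual_value p = (LBINT t:{0..}. price_profit_rate (price_path p) t)"

lemma undiscounted_price_path: "exp (\<beta> * t) * price_path p t = min (p * exp (\<beta> * t)) \<zeta>"
proof -
  have "exp (\<beta> * t) * (\<zeta> * exp (- \<beta> * t)) = \<zeta> * (exp (\<beta> * t) * exp (- \<beta> * t))" by simp
  also have "\<dots> = \<zeta>" by (simp flip: exp_add)
  finally have e: "exp (\<beta> * t) * (\<zeta> * exp (- \<beta> * t)) = \<zeta>" .
  have "exp (\<beta> * t) * price_path p t = min (exp (\<beta> * t) * p) (exp (\<beta> * t) * (\<zeta> * exp (- \<beta> * t)))"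
    unfolding price_path_def by (rule min_mult_distrib_left[THEN trans]) simp
  then show ?thesis unfolding e by (simp add: mult.commute)
qed

lemma antimono_price_path: "antimono_on S (price_path p)"
proof (rule monotone_onI)
  fix s t :: real assume "s \<le> t"
  then have "\<zeta> * exp (- \<beta> * t) \<le> \<zeta> * exp (- \<beta> * s)"
    using zeta_nonneg \<beta> by (intro mult_left_mono) auto
  then show "price_path p t \<le> price_path p s" unfolding price_path_def by linarith
qed

lemma price_path_nonneg: "0 \<le> p \<Longrightarrow> 0 \<le> price_path p t"
  using zeta_nonneg by (simp add: price_path_def)

lemma set_integrable_price_profit_rate:
  assumes "0 \<le> p"
  shows "set_integrable lborel {0..} (price_profit_rate (price_path p))"
proof -
  have contH: "continuous_on S H" for S by (simp add: continuous_at_imp_continuous_on isCont_H)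
  obtain K where K: "\<And>z. z \<in> {0..\<zeta>} \<Longrightarrow> \<bar>H z\<bar> \<le> K"
    using compact_imp_bounded[OF compact_continuous_image[OF contH compact_Icc[of 0 \<zeta>]]]
    by (auto simp: bounded_real) (metis atLeastAtMost_iff)
  show ?thesis
  proof (rule set_integrable_discounted[OF \<beta>, where K = K])
    have "continuous_on UNIV (price_profit_rate (price_path p))"
      unfolding price_profit_rate_def price_path_def
      by (intro continuous_intros continuous_on_compose2[OF contH[of UNIV]]) auto
    then have [measurable]: "price_profit_rate (price_path p) \<in> borel_measurable borel"
      by (rule borel_measurable_continuous_onI)
    show "set_borel_measurable lborel {0..} (price_profit_rate (price_path p))"
      unfolding set_borel_measurable_def by measurable
    show "\<bar>price_profit_rate (price_path p) t\<bar> \<le> K * exp (- \<beta> * t)" for t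
      unfolding price_profit_rate_def undiscounted_price_path
      using K[of "min (p * exp (\<beta> * t)) \<zeta>"] assms zeta_nonneg by (simp add: abs_mult mult.commute)
  qed
qed

lemma value_le_dual_value:
  assumes "p \<in> {0..\<zeta>}"
  shows "value_function A Q R C \<beta> x \<le> ereal (dual_value p + p * x)"
  unfolding value_function_def
proof (intro SUP_least, clarify)
  fix \<alpha> q assume adm: "(\<alpha>, q) \<in> admissible A Q x"
  have "price_path p 0 = p" using assms by (simp add: price_path_def)
  then show "payoff R C \<beta> \<alpha> q \<le> ereal (dual_value p + p * x)"
    using payoff_le[OF adm antimono_price_path price_path_nonneg set_integrable_price_profit_rate, of p] assms
    by (simp add: dual_value_def)
qed

lemma dual_value_zeta: "dual_value \<zeta> = H \<zeta> / \<beta>"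
proof -
  have "(LBINT t:{0..}. price_profit_rate (price_path \<zeta>) t) = (LBINT t:{0..}. H \<zeta> * exp (- \<beta> * t))"
  proof (rule set_lebesgue_integral_cong)
    show "\<forall>t. t \<in> {0..} \<longrightarrow> price_profit_rate (price_path \<zeta>) t = H \<zeta> * exp (- \<beta> * t)"
    proof (intro allI impI)
      fix t :: real assume t: "t \<in> {0..}"
      have "\<zeta> * 1 \<le> \<zeta> * exp (\<beta> * t)" using t \<beta> zeta_nonneg by (intro mult_left_mono) auto
      then show "price_profit_rate (price_path \<zeta>) t = H \<zeta> * exp (- \<beta> * t)"
        unfolding price_profit_rate_def undiscounted_price_path by simp
    qed
  qed simp
  also have "\<dots> = H \<zeta> * (1 / \<beta>)" unfolding set_integrable_exp_minus(2)[OF \<beta>, symmetric] by simp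
  finally show ?thesis by (simp add: dual_value_def)
qed

section \<open>Controls that approach the bound\<close>

text \<open>
  When the rates are optimal at every time for the current price, the estimate behind weak duality is an
  equality, and only the value of the net production remains to be controlled.
\<close>

lemma payoff_ge:
  assumes \<alpha>: "\<alpha> \<in> borel_measurable (restrict_space borel {0..})" "\<And>t. 0 \<le> t \<Longrightarrow> \<alpha> t \<le> B"
    and q: "q \<in> borel_measurable (restrict_space borel {0..})"
    and opt: "\<And>t. 0 \<le> t \<Longrightarrow> optimal_rates (exp (\<beta> * t) * lam t) (\<alpha> t) (q t)"
    and int: "set_integrable lborel {0..} (price_profit_rate lam)"
    and K: "\<And>T. T0 \<le> T \<Longrightarrow> (LBINT t:{0..T}. lam t * (\<alpha> t - q t)) \<le> K"
  shows "ereal ((LBINT t:{0..}. price_profit_rate lam t) - K) \<le> payoff R C \<beta> \<alpha> q"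
proof -
  let ?f = "profit_rate \<alpha> q" and ?g = "price_profit_rate lam" and ?w = "\<lambda>t. lam t * (\<alpha> t - q t)"
  have mem: "\<alpha> t \<in> A" "q t \<in> Q" if "0 \<le> t" for t using opt[OF that] by (auto simp: optimal_rates_def)
  obtain r where r: "\<And>q. q \<in> Q \<Longrightarrow> \<bar>R q\<bar> \<le> r"
    using compact_imp_bounded[OF compact_continuous_image[OF R(1) Q(1)]] by (auto simp: bounded_real)
  have "compact (A \<inter> {0..B})" using A(1) by (auto intro: closed_Int_compact)
  from compact_imp_bounded[OF compact_continuous_image[OF continuous_on_subset[OF C(1)] this]]
  obtain c where c: "\<And>a. a \<in> A \<inter> {0..B} \<Longrightarrow> \<bar>C a\<bar> \<le> c" unfolding bounded_real by blast
  have fint: "set_integrable lborel {0..} ?f"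
  proof (rule set_integrable_discounted[OF \<beta>, where K = "r + c"])
    show "set_borel_measurable lborel {0..} ?f" using profit_rate_measurable[OF \<alpha>(1) mem(1) q mem(2)] .
    fix t :: real assume t: "0 \<le> t"
    have "\<bar>R (q t) - C (\<alpha> t)\<bar> \<le> r + c"
      using r[of "q t"] c[of "\<alpha> t"] mem[OF t] \<alpha>(2)[OF t] A(2) by fastforce
    then show "\<bar>?f t\<bar> \<le> (r + c) * exp (- \<beta> * t)"
      by (simp add: profit_rate_def abs_mult mult.commute)
  qed
  have fg: "?f t = ?g t - ?w t" if "0 \<le> t" for t using opt[OF that] by (rule profit_rate_eq)
  have ge: "(LBINT t:{0..T}. ?g t) - K \<le> (LBINT t:{0..T}. ?f t)" if T: "T0 \<le> T" for T
  proof -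
    have i: "set_integrable lborel {0..T} ?f" "set_integrable lborel {0..T} ?g"
      using fint int by (auto intro: set_integrable_subset)
    have "(LBINT t:{0..T}. ?w t) = (LBINT t:{0..T}. ?g t - ?f t)"
      using fg by (intro set_lebesgue_integral_cong) auto
    also have "\<dots> = (LBINT t:{0..T}. ?g t) - (LBINT t:{0..T}. ?f t)"
      by (rule set_integral_diff(2)[OF i(2,1)])
    finally show ?thesis using K[OF T] by linarith
  qed
  have "(LBINT t:{0..}. ?g t) - K \<le> (LBINT t:{0..}. ?f t)"
  proof (rule tendsto_le)
    show "((\<lambda>T. LBINT t:{0..T}. ?f t) \<longlongrightarrow> (LBINT t:{0..}. ?f t)) at_top"
      by (rule tendsto_LBINT_atLeast[OF fint])
    show "((\<lambda>T. (LBINT t:{0..T}. ?g t) - K) \<longlongrightarrow> (LBINT t:{0..}. ?g t) - K) at_top"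
      by (intro tendsto_diff tendsto_const tendsto_LBINT_atLeast[OF int])
    show "\<forall>\<^sub>F T in at_top. (LBINT t:{0..T}. ?g t) - K \<le> (LBINT t:{0..T}. ?f t)"
      using ge by (rule eventually_at_top_linorderI)
  qed simp
  then show ?thesis by (simp add: payoff_eq extended_integral_eq[OF fint])
qed

text \<open>
  While the price rises at rate \<open>\<beta>\<close>, the stock is \<open>\<Psi>\<close> of the current price: substituting \<open>z = p * exp (\<beta> * s)\<close>
  turns the time integral of \<open>H'\<close> into the integral that defines \<open>\<Psi>\<close>.
\<close>

lemma rising_price_integral:
  assumes p: "p \<in> {0<..\<zeta>}" and t: "0 \<le> t" "p * exp (\<beta> * t) \<le> \<zeta>"
  shows "(LBINT s:{0..t}. marginal (p * exp (\<beta> * s))) = Psi H \<beta> (p * exp (\<beta> * t)) - Psi H \<beta> p"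
proof -
  let ?g = "\<lambda>s. p * exp (\<beta> * s)" and ?g' = "\<lambda>s. p * exp (\<beta> * s) * \<beta>"
  have le: "p * 1 \<le> p * exp (\<beta> * t)" using p t \<beta> by (intro mult_left_mono) auto
  have sub: "subgradient_on {p..?g t} (Psi H \<beta>) Psi_slope"
    by (rule subgradient_on_subset[OF subgradient_Psi]) (use p t in auto)
  have "Psi H \<beta> (?g t) - Psi H \<beta> p = (LBINT z:{p..?g t}. Psi_slope z)"
    using subgradient_on_integral_eq[OF sub] le by simp
  also have "\<dots> = (LBINT z. Psi_slope z * indicator {?g 0..?g t} z)"
    by (simp add: set_lebesgue_integral_def mult.commute)
  also have "\<dots> = (LBINT s. Psi_slope (?g s) * ?g' s * indicator {0..t} s)"
  proof (rule integral_substitution(2))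
    show "set_integrable lborel {?g 0..?g t} Psi_slope"
      using set_integrable_mono_on[OF subgradient_on_mono[OF sub]] by simp
    show "(?g has_real_derivative ?g' s) (at s)" for s by (auto intro!: derivative_eq_intros)
  qed (use p t \<beta> in \<open>auto intro!: continuous_intros\<close>)
  also have "\<dots> = (LBINT s:{0..t}. marginal (?g s))"
    unfolding set_lebesgue_integral_def
    by (rule Bochner_Integration.integral_cong) (use p \<beta> in \<open>auto simp: Psi_slope_def indicator_def\<close>)
  finally show ?thesis by simp
qed

text \<open>
  Starting with at least \<open>\<Psi> p\<close>, the rates that are optimal at the rising price reduce the stock by exactly
  \<open>\<Psi> p\<close> until the price reaches \<open>\<zeta>\<close> at time \<open>\<tau>\<close>; then switching between two optimal pairs keeps the stock
  nonnegative. The discounted price equals \<open>p\<close> until \<open>\<tau>\<close>, so the first phase contributes \<open>p * \<Psi> p\<close> and the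
  switching costs at most \<open>p * \<delta> * u1\<close>. The case \<open>p = \<zeta>\<close> consists of the second phase alone and includes
  \<open>\<zeta> = 0\<close>.
\<close>

lemma value_ge_dual_value:
  assumes p: "p = \<zeta> \<or> p \<in> {0<..<\<zeta>}" and x: "Psi H \<beta> p \<le> x"
  shows "ereal (dual_value p + p * Psi H \<beta> p) \<le> value_function A Q R C \<beta> x"
proof -
  obtain a1 q1 where opt1: "optimal_rates \<zeta> a1 q1" and u1: "0 \<le> a1 - q1"
    using optimal_rates_of_sign[of 1] by auto
  obtain a2 q2 where opt2: "optimal_rates \<zeta> a2 q2" and u2: "a2 - q2 \<le> 0"
    using optimal_rates_of_sign[of "-1"] by auto
  define u1 u2 where "u1 = a1 - q1" and "u2 = a2 - q2"
  have u: "u2 \<le> 0" "0 \<le> u1" using u1 u2 by (auto simp: u1_def u2_def)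
  \<comment> \<open>If both rates vanish, the denominator is \<open>0\<close> and the quotient defaults to the admissible value \<open>0\<close>.\<close>
  define \<theta> where "\<theta> = - u2 / (u1 - u2)"
  have \<theta>: "0 \<le> \<theta>" "\<theta> \<le> 1" "\<theta> * u1 + (1 - \<theta>) * u2 = 0"
    using u by (auto simp: \<theta>_def divide_simps algebra_simps)
  define \<tau> where "\<tau> = (if p = \<zeta> then 0 else ln (\<zeta> / p) / \<beta>)"
  have \<tau>0: "0 \<le> \<tau>" using p \<beta> by (auto simp: \<tau>_def)
  have \<tau>p: "p * exp (\<beta> * \<tau>) = \<zeta>" using p \<beta> by (auto simp: \<tau>_def)
  have p0: "0 \<le> p" "p \<le> \<zeta>" using p zeta_nonneg by auto
  have pw: "p \<in> {0<..\<zeta>}" if "0 < \<tau>" using that p by (auto simp: \<tau>_def)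
  have before: "p * exp (\<beta> * t) < \<zeta>" if "0 \<le> t" "t < \<tau>" for t
  proof -
    have "p * exp (\<beta> * t) < p * exp (\<beta> * \<tau>)" using that pw \<beta> by (intro mult_strict_left_mono) auto
    then show ?thesis using \<tau>p by simp
  qed
  have after: "\<zeta> \<le> p * exp (\<beta> * t)" if "\<tau> \<le> t" for t
  proof -
    have "p * exp (\<beta> * \<tau>) \<le> p * exp (\<beta> * t)" using that p0 \<beta> by (intro mult_left_mono) auto
    then show ?thesis using \<tau>p by simp
  qed
  have bound: "ereal (dual_value p + p * Psi H \<beta> p - p * (\<delta> * u1)) \<le> value_function A Q R C \<beta> x"
    if \<delta>: "0 < \<delta>" for \<delta>
  proof -
    define \<alpha> where "\<alpha> t = (if t < \<tau> then best_production (p * exp (\<beta> * t)) else switching \<tau> \<delta> \<theta> a1 a2 t)" for t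
    define q where "q t = (if t < \<tau> then best_sales (p * exp (\<beta> * t)) else switching \<tau> \<delta> \<theta> q1 q2 t)" for t
    let ?u = "\<lambda>t. \<alpha> t - q t" and ?lam = "price_path p"
    have [measurable]: "best_production \<in> borel_measurable borel"
      by (rule borel_measurable_mono[OF best_production_mono])
    have "(\<lambda>z. - best_sales z) \<in> borel_measurable borel"
      by (rule borel_measurable_mono) (use best_sales_antimono in \<open>auto simp: mono_def antimono_def\<close>)
    then have [measurable]: "best_sales \<in> borel_measurable borel" by simp
    have meas [measurable]: "\<alpha> \<in> borel_measurable borel" "q \<in> borel_measurable borel"
      unfolding \<alpha>_def q_def by measurable
    have u_before: "?u t = marginal (p * exp (\<beta> * t))" if "0 \<le> t" "t < \<tau>" for t
      using before[OF that] that by (simp add: \<alpha>_def q_def marginal_def net_production_def)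
    have u_after: "?u t = switching \<tau> \<delta> \<theta> u1 u2 t" if "\<tau> \<le> t" for t
      using that by (simp add: \<alpha>_def q_def switching_def u1_def u2_def)
    have opt: "optimal_rates (exp (\<beta> * t) * ?lam t) (\<alpha> t) (q t)" if "0 \<le> t" for t
    proof (cases "t < \<tau>")
      case True
      then show ?thesis
        unfolding undiscounted_price_path using before[OF that True] by (simp add: \<alpha>_def q_def optimal_best)
    next
      case False
      then show ?thesis
        unfolding undiscounted_price_path using after[of t] opt1 opt2 by (simp add: \<alpha>_def q_def switching_def)
    qed
    have mem: "\<alpha> t \<in> A" "q t \<in> Q" if "0 \<le> t" for t using opt[OF that] by (auto simp: optimal_rates_def)
    define B where "B = best_production \<zeta> + a1 + a2"
    have \<alpha>B: "\<alpha> t \<le> B" if "0 \<le> t" for t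
    proof -
      have "0 \<le> best_production \<zeta>" "0 \<le> a1" "0 \<le> a2"
        using best_production(1)[of \<zeta>] opt1 opt2 A(2) by (auto simp: optimal_rates_def)
      then show ?thesis
        using monoD[OF best_production_mono, of "p * exp (\<beta> * t)" \<zeta>] before[OF that]
        by (auto simp: \<alpha>_def B_def switching_def)
    qed
    have \<alpha>int: "set_integrable lborel {0..t} \<alpha>" for t
    proof (rule set_integrable_bounded_Icc[OF meas(1)])
      fix s assume "s \<in> {0..t}"
      then show "\<bar>\<alpha> s\<bar> \<le> B" using mem(1)[of s] \<alpha>B[of s] A(2) by auto
    qed
    have meas': "\<alpha> \<in> borel_measurable (restrict_space borel {0..})" "q \<in> borel_measurable (restrict_space borel {0..})"
      by (auto intro: measurable_restrict_space1 meas)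
    have uint: "set_integrable lborel {a..t} ?u" if "0 \<le> a" for a t
      using \<alpha>int set_integrable_sales[OF meas'(2) mem(2)] that
      by (intro set_integrable_subset[OF set_integral_diff(1), of lborel "{0..t}"]) auto
    have U_before: "(LBINT s:{0..t}. ?u s) = Psi H \<beta> (p * exp (\<beta> * t)) - Psi H \<beta> p" if t: "0 \<le> t" "t \<le> \<tau>" for t
    proof (cases "0 < \<tau>")
      case True
      have "p * exp (\<beta> * t) \<le> \<zeta>" using before[OF t(1)] t(2) \<tau>p by (cases "t = \<tau>") auto
      from rising_price_integral[OF pw[OF True] t(1) this]
      have "(LBINT s:{0..t}. marginal (p * exp (\<beta> * s))) = Psi H \<beta> (p * exp (\<beta> * t)) - Psi H \<beta> p" .
      moreover have "(LBINT s:{0..t}. ?u s) = (LBINT s:{0..t}. marginal (p * exp (\<beta> * s)))"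
        unfolding set_lebesgue_integral_def
      proof (rule integral_discrete_difference)
        show "countable {\<tau>}" by simp
      qed (use t u_before in \<open>auto simp: indicator_def\<close>)
      ultimately show ?thesis by simp
    next
      case False
      then have "t = 0" using t by simp
      then show ?thesis by (simp add: LBINT_point)
    qed
    have U_split: "(LBINT s:{0..t}. ?u s) = - Psi H \<beta> p + (LBINT s:{\<tau>..t}. switching \<tau> \<delta> \<theta> u1 u2 s)" if t: "\<tau> \<le> t" for t
    proof -
      have "(LBINT s:{0..t}. ?u s) = (LBINT s:{0..\<tau>}. ?u s) + (LBINT s:{\<tau>..t}. ?u s)"
        by (rule set_integral_split[OF \<tau>0 t uint]) simp
      moreover have "(LBINT s:{\<tau>..t}. ?u s) = (LBINT s:{\<tau>..t}. switching \<tau> \<delta> \<theta> u1 u2 s)"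
        using u_after by (intro set_lebesgue_integral_cong) auto
      ultimately show ?thesis using U_before[OF \<tau>0] \<tau>p Psi_zeta by simp
    qed
    note sw = switching_integral_bounds[OF \<delta> \<theta>(1,2) u \<theta>(3)]
    have state: "0 \<le> state_path x \<alpha> q t" if t: "0 \<le> t" for t
    proof (cases "t < \<tau>")
      case True
      have "0 < p" using pw True t by simp
      then have "0 \<le> Psi H \<beta> (p * exp (\<beta> * t))" using before[OF t True] by (intro Psi_nonneg) auto
      then show ?thesis using U_before[OF t] True x by (simp add: state_path_def)
    next
      case False
      then show ?thesis using U_split[of t] sw(1)[of \<tau> t] x by (simp add: state_path_def)
    qed
    have adm: "(\<alpha>, q) \<in> admissible A Q x"
      using meas' mem \<alpha>int state by (auto simp: admissible_def)
    have lam: "?lam t = p" if "0 \<le> t" "t \<le> \<tau>" for t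
    proof -
      have "p * exp (\<beta> * t) \<le> \<zeta>" using before[OF that(1)] that(2) \<tau>p by (cases "t = \<tau>") auto
      then have "exp (\<beta> * t) * ?lam t = exp (\<beta> * t) * p" unfolding undiscounted_price_path by simp
      then show ?thesis by simp
    qed
    have K: "(LBINT t:{0..T}. ?lam t * ?u t) \<le> - (p * Psi H \<beta> p) + p * (\<delta> * u1)" if T: "\<tau> \<le> T" for T
    proof -
      have "(LBINT t:{0..T}. ?lam t * ?u t) = (LBINT t:{0..\<tau>}. ?lam t * ?u t) + (LBINT t:{\<tau>..T}. ?lam t * ?u t)"
        by (rule set_integral_split[OF \<tau>0 T set_integrable_antimono_weight[OF uint antimono_price_path]]) simp
      moreover have "(LBINT t:{0..\<tau>}. ?lam t * ?u t) = (LBINT t:{0..\<tau>}. p * ?u t)"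
        using lam by (intro set_lebesgue_integral_cong) auto
      moreover have "\<dots> = - (p * Psi H \<beta> p)"
        using U_before[OF \<tau>0] \<tau>p Psi_zeta by simp
      moreover have "(LBINT t:{\<tau>..T}. ?lam t * ?u t) \<le> ?lam \<tau> * (\<delta> * u1)"
      proof (rule antimono_weight_integral_bounds(2)[OF uint antimono_price_path T price_path_nonneg])
        fix t assume t: "t \<in> {\<tau>..T}"
        have "(LBINT s:{\<tau>..t}. ?u s) = (LBINT s:{\<tau>..t}. switching \<tau> \<delta> \<theta> u1 u2 s)"
          using u_after by (intro set_lebesgue_integral_cong) auto
        then show "(LBINT s:{\<tau>..t}. ?u s) \<le> \<delta> * u1" using sw(2)[of \<tau> t] t by simp
      qed (use \<tau>0 p0 in auto)
      ultimately show ?thesis using lam[OF \<tau>0] by simp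
    qed
    have "ereal ((LBINT t:{0..}. price_profit_rate ?lam t) - (- (p * Psi H \<beta> p) + p * (\<delta> * u1))) \<le> payoff R C \<beta> \<alpha> q"
      by (rule payoff_ge[OF meas'(1) \<alpha>B meas'(2) opt set_integrable_price_profit_rate[OF p0(1)] K])
    also have "\<dots> \<le> value_function A Q R C \<beta> x"
      unfolding value_function_def using adm by (intro SUP_upper2[of "(\<alpha>, q)"]) auto
    finally show ?thesis by (simp add: dual_value_def algebra_simps)
  qed
  show ?thesis
  proof (rule ereal_le_epsilon2)
    fix e :: real assume e: "0 < e"
    \<comment> \<open>Small enough for the switching loss \<open>p * \<delta> * u1\<close> not to exceed \<open>e\<close>; the \<open>1\<close> avoids a zero denominator.\<close>
    define \<delta> where "\<delta> = e / (p * u1 + 1)"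
    have pu: "0 \<le> p * u1" using p0 u by simp
    then have \<delta>: "0 < \<delta>" using e by (simp add: \<delta>_def)
    have "p * (\<delta> * u1) \<le> e" using pu e by (simp add: \<delta>_def field_simps)
    then have "ereal (dual_value p + p * Psi H \<beta> p - e) \<le> value_function A Q R C \<beta> x"
      using bound[OF \<delta>] by (meson diff_left_mono ereal_less_eq(3) order_trans)
    then show "ereal (dual_value p + p * Psi H \<beta> p) \<le> value_function A Q R C \<beta> x + ereal e"
      by (cases "value_function A Q R C \<beta> x") auto
  qed
qed

section \<open>The value function\<close>

lemma value_eq_if_zero_minimizer:
  assumes "\<zeta> = 0" "0 \<le> x"
  shows "value_function A Q R C \<beta> x = ereal (H 0 / \<beta>)"
proof (rule antisym)
  show "value_function A Q R C \<beta> x \<le> ereal (H 0 / \<beta>)"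
    using value_le_dual_value[of 0 x] dual_value_zeta assms by simp
  show "ereal (H 0 / \<beta>) \<le> value_function A Q R C \<beta> x"
    using value_ge_dual_value[of 0 x] Psi_zeta dual_value_zeta assms by simp
qed

lemma dual_value_minimal:
  assumes "p \<in> {0<..\<zeta>}" "r \<in> {0..\<zeta>}"
  shows "dual_value p + p * Psi H \<beta> p \<le> dual_value r + r * Psi H \<beta> p"
proof -
  have "ereal (dual_value p + p * Psi H \<beta> p) \<le> value_function A Q R C \<beta> (Psi H \<beta> p)"
    using assms by (intro value_ge_dual_value) auto
  also have "\<dots> \<le> ereal (dual_value r + r * Psi H \<beta> p)"
    by (rule value_le_dual_value[OF assms(2)])
  finally show ?thesis by simp
qed

text \<open>
  By \<open>dual_value_minimal\<close>, \<open>- \<Psi>\<close> is a subgradient of the dual value. Formally, the derivative of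
  \<open>dual_value p + p * \<Psi> p\<close> is therefore \<open>p * \<Psi>' p = H' p / \<beta>\<close>; the partition lemma makes this rigorous
  at the kinks of \<open>H\<close>.
\<close>

lemma dual_value_eq:
  assumes p: "p \<in> {0<..\<zeta>}"
  shows "dual_value p + p * Psi H \<beta> p = H p / \<beta>"
proof -
  define D where "D z = dual_value z + z * Psi H \<beta> z - H z / \<beta>" for z
  have "D p = D \<zeta>"
  proof (rule eq_if_increments_le_mono[where D = D and M = "\<lambda>z. \<zeta> * Psi_slope z"])
    show "p \<le> \<zeta>" using p by simp
    fix x y assume xy: "p \<le> x" "x \<le> y" "y \<le> \<zeta>"
    then have x: "x \<in> {0<..\<zeta>}" and y: "y \<in> {0<..\<zeta>}" using p by auto
    let ?k = Psi_slope and ?P = "Psi H \<beta>"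
    have k: "?k x \<le> ?k y" using mono_onD[OF Psi_slope_mono x y xy(2)] .
    have marg: "marginal z * (y - x) / \<beta> = z * ?k z * (y - x)" if "z \<in> {0<..\<zeta>}" for z
      using that \<beta> by (simp add: Psi_slope_def)
    have "marginal x * (y - x) / \<beta> \<le> (H y - H x) / \<beta>"
      by (rule divide_right_mono[OF subgradient_increment_bounds(1)[OF subgradient_H_marginal]]) (use x y \<beta> in auto)
    then have low_H: "x * ?k x * (y - x) \<le> H y / \<beta> - H x / \<beta>"
      by (simp only: marg[OF x] diff_divide_distrib)
    have "(H y - H x) / \<beta> \<le> marginal y * (y - x) / \<beta>"
      by (rule divide_right_mono[OF subgradient_increment_bounds(2)[OF subgradient_H_marginal]]) (use x y \<beta> in auto)
    then have high_H: "H y / \<beta> - H x / \<beta> \<le> y * ?k y * (y - x)"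
      by (simp only: marg[OF y] diff_divide_distrib)
    have P: "?k x * (y - x) \<le> ?P y - ?P x" "?P y - ?P x \<le> ?k y * (y - x)"
      using subgradient_increment_bounds[OF subgradient_Psi x y] by auto
    have d: "dual_value x + x * ?P x \<le> dual_value y + y * ?P x" "dual_value y + y * ?P y \<le> dual_value x + x * ?P y"
      using x y by (auto intro: dual_value_minimal)
    have "y * (?k x * (y - x)) \<le> y * (?P y - ?P x)" using P(1) y by (intro mult_left_mono) auto
    then have low: "y * ?k x * (y - x) \<le> (dual_value y + y * ?P y) - (dual_value x + x * ?P x)"
      using d(1) by (simp add: algebra_simps)
    have "x * (?P y - ?P x) \<le> x * (?k y * (y - x))" using P(2) x by (intro mult_left_mono) auto
    then have high: "(dual_value y + y * ?P y) - (dual_value x + x * ?P x) \<le> x * ?k y * (y - x)"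
      using d(2) by (simp add: algebra_simps)
    define e where "e = (?k y - ?k x) * (y - x)"
    have e: "0 \<le> e" using k xy by (simp add: e_def)
    have "x * e \<le> \<zeta> * e" "y * e \<le> \<zeta> * e" using x y e by (auto intro: mult_right_mono)
    moreover have "D y - D x \<le> x * e" using high low_H by (simp add: D_def e_def algebra_simps)
    moreover have "- (y * e) \<le> D y - D x" using low high_H by (simp add: D_def e_def algebra_simps)
    ultimately have "\<bar>D y - D x\<bar> \<le> \<zeta> * e" by linarith
    then show "\<bar>D y - D x\<bar> \<le> (\<zeta> * ?k y - \<zeta> * ?k x) * (y - x)" by (simp add: e_def algebra_simps)
  qed
  also have "D \<zeta> = 0" by (simp add: D_def dual_value_zeta Psi_zeta)
  finally show ?thesis by (simp add: D_def)
qed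

context
  assumes pos: "0 < \<zeta>"
begin

lemma value_eq:
  assumes "0 \<le> x"
  shows "value_function A Q R C \<beta> x = ereal (H (\<xi> x) / \<beta>)"
proof -
  have p: "\<xi> x \<in> {0<..\<zeta>}" and x: "Psi H \<beta> (\<xi> x) = x"
    using xi_range[OF pos assms] Psi_xi[OF pos assms] by auto
  have eq: "dual_value (\<xi> x) + \<xi> x * x = H (\<xi> x) / \<beta>" using dual_value_eq[OF p] x by simp
  show ?thesis
  proof (rule antisym)
    show "value_function A Q R C \<beta> x \<le> ereal (H (\<xi> x) / \<beta>)"
      using value_le_dual_value[of "\<xi> x" x] p eq by simp
    show "ereal (H (\<xi> x) / \<beta>) \<le> value_function A Q R C \<beta> x"
      using value_ge_dual_value[of "\<xi> x" x] p x eq by (cases "\<xi> x = \<zeta>") auto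
  qed
qed

text \<open>The price \<open>\<xi> x\<close> is optimal in the dual bound at \<open>x\<close>, and that bound is affine in the initial stock.\<close>

lemma subgradient_value: "subgradient_on {0..} (\<lambda>x. - (H (\<xi> x) / \<beta>)) (\<lambda>x. - \<xi> x)"
  unfolding subgradient_on_def
proof (intro ballI)
  fix x y :: real assume xy: "x \<in> {0..}" "y \<in> {0..}"
  have p: "\<xi> x \<in> {0<..\<zeta>}" and x: "Psi H \<beta> (\<xi> x) = x"
    using xi_range[OF pos] Psi_xi[OF pos] xy by auto
  have "H (\<xi> y) / \<beta> \<le> dual_value (\<xi> x) + \<xi> x * y"
    using value_le_dual_value[of "\<xi> x" y] value_eq[of y] p xy by simp
  then show "- (H (\<xi> x) / \<beta>) + - \<xi> x * (y - x) \<le> - (H (\<xi> y) / \<beta>)"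
    using dual_value_eq[OF p] x by (simp add: algebra_simps)
qed

lemma value_tangent:
  assumes "0 \<le> x" "0 \<le> y"
  shows "H (\<xi> y) / \<beta> \<le> H (\<xi> x) / \<beta> + \<xi> x * (y - x)"
  using subgradient_onD[OF subgradient_value, of x y] assms by simp

text \<open>
  Passing to the tangent at the midpoint gains \<open>(\<xi> x - \<xi> m) * (y - m)\<close>, which is positive as \<open>\<xi>\<close> is strictly
  decreasing.
\<close>

lemma value_tangent_strict:
  assumes xy: "0 \<le> x" "0 \<le> y" "x \<noteq> y"
  shows "H (\<xi> y) / \<beta> < H (\<xi> x) / \<beta> + \<xi> x * (y - x)"
proof -
  define m where "m = (x + y) / 2"
  have m: "0 \<le> m" using xy by (simp add: m_def)
  have "0 < (\<xi> x - \<xi> m) * (y - m)"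
    using xi_less_iff[OF pos xy(1) m] xi_less_iff[OF pos m xy(1)] xy
    by (cases "x < y") (auto simp: m_def zero_less_mult_iff)
  then show ?thesis
    using value_tangent[OF m xy(2)] value_tangent[OF xy(1) m] by (simp add: algebra_simps)
qed

lemma value_integral:
  assumes "0 \<le> x"
  shows "H (\<xi> x) / \<beta> = H \<zeta> / \<beta> + (LBINT y:{0..x}. \<xi> y)"
proof -
  have "(LBINT y:{0..x}. - \<xi> y) = - (H (\<xi> x) / \<beta>) - - (H (\<xi> 0) / \<beta>)"
    by (rule subgradient_on_integral_eq[OF subgradient_on_subset[OF subgradient_value] assms]) auto
  moreover have "(LBINT y:{0..x}. - \<xi> y) = - (LBINT y:{0..x}. \<xi> y)"
    by (simp add: set_lebesgue_integral_def)
  ultimately show ?thesis using xi_0[OF pos] by simp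
qed

lemma value_less:
  assumes "0 \<le> x" "x < y"
  shows "H (\<xi> x) / \<beta> < H (\<xi> y) / \<beta>"
proof -
  have "\<xi> y * (x - y) < 0" using xi_range[OF pos, of y] assms by (intro mult_pos_neg) auto
  then show ?thesis using value_tangent[of y x] assms by simp
qed

lemma value_strictly_concave: "strictly_concave_on {0..} (\<lambda>x. H (\<xi> x) / \<beta>)"
  unfolding strictly_concave_on_def
proof (intro conjI ballI allI impI)
  fix x y u :: real assume x: "x \<in> {0..}" and y: "y \<in> {0..}" and u: "x \<noteq> y \<and> 0 < u \<and> u < 1"
  let ?V = "\<lambda>x. H (\<xi> x) / \<beta>"
  define w where "w = (1 - u) * x + u * y"
  have dist: "w - x = u * (y - x)" "w - y = (1 - u) * (x - y)" by (auto simp: w_def algebra_simps)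
  then have ne: "w \<noteq> x" "w \<noteq> y" using u by auto
  have w: "0 \<le> w" using x y u by (simp add: w_def)
  have "(1 - u) * ?V x < (1 - u) * (?V w + \<xi> w * (x - w))"
    using value_tangent_strict[OF w, of x] x ne u by (intro mult_strict_left_mono) auto
  moreover have "u * ?V y < u * (?V w + \<xi> w * (y - w))"
    using value_tangent_strict[OF w, of y] y ne u by (intro mult_strict_left_mono) auto
  moreover have "(1 - u) * (c + d * (x - w)) + u * (c + d * (y - w)) = c" for c d
    unfolding w_def by (simp add: algebra_simps)
  ultimately have "(1 - u) * ?V x + u * ?V y < ?V w"
    using add_strict_mono by metis
  then show "(1 - u) * ?V x + u * ?V y < ?V ((1 - u) * x + u * y)"
    by (simp only: w_def)
qed simp

lemma value_has_derivative:
  assumes "0 \<le> x"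
  shows "((\<lambda>x. H (\<xi> x) / \<beta>) has_real_derivative \<xi> x) (at x within {0..})"
proof -
  have "continuous (at x within {0..}) (\<lambda>x. - \<xi> x)"
    by (intro continuous_intros xi_continuous[OF pos assms])
  from subgradient_on_has_derivative[OF subgradient_value _ this] assms
  have "((\<lambda>x. - (H (\<xi> x) / \<beta>)) has_real_derivative - \<xi> x) (at x within {0..})" by simp
  from DERIV_minus[OF this] show ?thesis by simp
qed

lemma value_tendsto: "((\<lambda>x. H (\<xi> x) / \<beta>) \<longlongrightarrow> H 0 / \<beta>) at_top"
  using \<beta> by (intro tendsto_divide tendsto_const isCont_tendsto_compose[OF isCont_H xi_tendsto_0[OF pos]]) auto

lemma value_bounds:
  assumes "0 \<le> x"
  shows "H \<zeta> / \<beta> \<le> H (\<xi> x) / \<beta>" "H (\<xi> x) / \<beta> \<le> H 0 / \<beta>"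
proof -
  show "H \<zeta> / \<beta> \<le> H (\<xi> x) / \<beta>" using zeta_minimizes \<beta> by (simp add: divide_right_mono)
  show "H (\<xi> x) / \<beta> \<le> H 0 / \<beta>"
  proof (rule tendsto_lowerbound[OF value_tendsto])
    show "\<forall>\<^sub>F y in at_top. H (\<xi> x) / \<beta> \<le> H (\<xi> y) / \<beta>"
      using value_less[OF assms] by (intro eventually_at_top_linorderI[of x]) (metis order.order_iff_strict)
  qed simp
qed

end

end

theorem theorem1:
  fixes A Q :: "real set" and R C :: "real \<Rightarrow> real" and \<beta> :: real
    and v :: "real \<Rightarrow> ereal" and H \<xi> :: "real \<Rightarrow> real" and \<zeta> :: real
  assumes A: "closed A" "A \<subseteq> {0..}" "0 \<in> A" "A - {0} \<noteq> {}"
    and Q: "compact Q" "Q \<subseteq> {0..}" "0 \<in> Q" "Q - {0} \<noteq> {}"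
    and R: "continuous_on Q R" "\<And>q. q \<in> Q \<Longrightarrow> 0 \<le> R q" "R 0 = 0"
    and C: "continuous_on A C" "\<And>a. a \<in> A \<Longrightarrow> 0 \<le> C a" "mono_on A C"
      "\<not> bounded A \<Longrightarrow> filterlim (\<lambda>a. C a / a) at_top (inf at_top (principal A))"
    and \<beta>: "0 < \<beta>"
    and v: "v = value_function A Q R C \<beta>"
    and H: "H = hamiltonian A Q R C"
    and \<zeta>: "\<zeta> = least_minimizer H"
    and \<xi>: "\<xi> = xi H \<beta>"
  shows "0 \<le> \<zeta> \<and>
    (\<exists>M::real. \<forall>x\<ge>0. \<bar>v x\<bar> \<le> ereal M) \<and>
    (\<forall>x\<ge>0. v x \<le> ereal (H 0 / \<beta>)) \<and>
    (v \<longlongrightarrow> ereal (H 0 / \<beta>)) at_top \<and>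
    (\<zeta> = 0 \<longrightarrow> (\<forall>x\<ge>0. v x = ereal (H 0 / \<beta>))) \<and>
    (\<zeta> > 0 \<longrightarrow>
      (\<forall>x\<ge>0. \<exists>!s. s \<in> {0<..\<zeta>} \<and> x = Psi H \<beta> s) \<and>
      (\<forall>x\<ge>0. v x = ereal (H (\<xi> x) / \<beta>) \<and>
               v x = ereal (H \<zeta> / \<beta> + (LBINT y:{0..x}. \<xi> y))) \<and>
      strict_mono_on {0..} v \<and>
      strictly_concave_on {0..} (\<lambda>x. real_of_ereal (v x)) \<and>
      (\<exists>v'. (\<forall>x\<ge>0. ((\<lambda>x. real_of_ereal (v x)) has_real_derivative v' x) (at x within {0..})) \<and>
            absolutely_continuous_fun_on {0..} v' \<and>
            v' 0 = \<zeta> \<and>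
            (v' \<longlongrightarrow> 0) at_top \<and>
            (AE x in lborel. 0 < x \<longrightarrow> (\<exists>d<0. (v' has_real_derivative d) (at x)))))"
proof -
  interpret production_problem A Q R C \<beta>
    by unfold_locales (use A Q R C \<beta> in auto)
  have main: ?thesis if pos: "0 < least_minimizer (hamiltonian A Q R C)"
  proof -
    let ?H = "hamiltonian A Q R C"
    have veq: "v x = ereal (?H (xi ?H \<beta> x) / \<beta>)" if "0 \<le> x" for x
      using value_eq[OF pos that] by (simp add: v)
    have real_v: "((\<lambda>x. real_of_ereal (v x)) has_real_derivative \<xi> x) (at x within {0..})" if "0 \<le> x" for x
      using value_has_derivative[OF pos that] that veq
      by (subst has_field_derivative_cong_eventually) (auto simp: eventually_at_filter \<xi> H)
    have concave: "strictly_concave_on {0..} (\<lambda>x. real_of_ereal (v x))"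
    proof -
      have "0 \<le> (1 - u) * x + u * y" if "0 \<le> x" "0 \<le> y" "0 < u" "u < 1" for x y u :: real
        using that by simp
      then show ?thesis
        using value_strictly_concave[OF pos] veq by (auto simp: strictly_concave_on_def)
    qed
    show ?thesis
    proof (intro conjI impI)
      show "0 \<le> \<zeta>" using zeta_nonneg by (simp add: \<zeta> H)
      show "\<exists>M::real. \<forall>x\<ge>0. \<bar>v x\<bar> \<le> ereal M"
      proof (intro exI allI impI)
        fix x :: real assume x: "0 \<le> x"
        have "\<bar>?H (xi ?H \<beta> x) / \<beta>\<bar> \<le> \<bar>?H (least_minimizer ?H) / \<beta>\<bar> + \<bar>?H 0 / \<beta>\<bar>"
          using value_bounds[OF pos x] by linarith
        then show "\<bar>v x\<bar> \<le> ereal (\<bar>?H (least_minimizer ?H) / \<beta>\<bar> + \<bar>?H 0 / \<beta>\<bar>)"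
          by (simp only: veq[OF x] abs_ereal.simps ereal_less_eq(3))
      qed
      show "\<forall>x\<ge>0. v x \<le> ereal (H 0 / \<beta>)"
        using veq value_bounds(2)[OF pos] by (simp add: H)
      have "((\<lambda>x. ereal (?H (xi ?H \<beta> x) / \<beta>)) \<longlongrightarrow> ereal (H 0 / \<beta>)) at_top"
        using value_tendsto[OF pos] by (simp add: H)
      then show "(v \<longlongrightarrow> ereal (H 0 / \<beta>)) at_top"
        by (rule Lim_transform_eventually) (use veq in \<open>auto intro!: eventually_at_top_linorderI[of 0]\<close>)
      show "\<forall>x\<ge>0. v x = ereal (H 0 / \<beta>)" if "\<zeta> = 0" using that pos by (simp add: \<zeta> H)
      show "\<forall>x\<ge>0. \<exists>!s. s \<in> {0<..\<zeta>} \<and> x = Psi H \<beta> s"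
        using Psi_ex1[OF pos] by (simp add: \<zeta> H)
      show "\<forall>x\<ge>0. v x = ereal (H (\<xi> x) / \<beta>) \<and> v x = ereal (H \<zeta> / \<beta> + (LBINT y:{0..x}. \<xi> y))"
        using veq value_integral[OF pos] by (simp add: \<zeta> H \<xi>)
      show "strict_mono_on {0..} v"
        using veq value_less[OF pos] by (auto intro!: strict_mono_onI)
      show "strictly_concave_on {0..} (\<lambda>x. real_of_ereal (v x))" by (rule concave)
      show "\<exists>v'. (\<forall>x\<ge>0. ((\<lambda>x. real_of_ereal (v x)) has_real_derivative v' x) (at x within {0..})) \<and>
            absolutely_continuous_fun_on {0..} v' \<and> v' 0 = \<zeta> \<and> (v' \<longlongrightarrow> 0) at_top \<and>
            (AE x in lborel. 0 < x \<longrightarrow> (\<exists>d<0. (v' has_real_derivative d) (at x)))"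
      proof (intro exI[of _ \<xi>] conjI allI impI real_v)
        show "absolutely_continuous_fun_on {0..} \<xi>"
          unfolding \<xi> H
          by (intro absolutely_continuous_antimono antimono_xi xi_continuous xi_lipschitz pos) auto
        show "\<xi> 0 = \<zeta>" using xi_0[OF pos] by (simp add: \<zeta> H \<xi>)
        show "(\<xi> \<longlongrightarrow> 0) at_top" using xi_tendsto_0[OF pos] by (simp add: H \<xi>)
        show "AE x in lborel. 0 < x \<longrightarrow> (\<exists>d<0. (\<xi> has_real_derivative d) (at x))"
          using xi_AE_derivative[OF pos] by (simp add: H \<xi>)
      qed
    qed
  qed
  show ?thesis
  proof (cases "\<zeta> = 0")
    case True
    have veq: "v x = ereal (H 0 / \<beta>)" if "0 \<le> x" for x
      using value_eq_if_zero_minimizer[of x] that True by (simp add: v \<zeta> H)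
    have "(v \<longlongrightarrow> ereal (H 0 / \<beta>)) at_top"
      by (rule tendsto_eventually) (use veq in \<open>auto intro!: eventually_at_top_linorderI[of 0]\<close>)
    then show ?thesis using veq True by (auto intro!: exI[of _ "\<bar>H 0 / \<beta>\<bar>"])
  next
    case False
    then have "0 < least_minimizer (hamiltonian A Q R C)" using zeta_nonneg by (simp add: \<zeta> H)
    then show ?thesis by (rule main)
  qed
qed

end
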